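(* Let $\mathfrak g$ be a Leibniz algebra over a field of characteristic $0$, and regard the free graded Lie algebra $F_{Lie}\,\mathfrak g[1]$ as a subspace of the tensor space $\bar T\mathfrak g[1]$ via the graded commutator embedding $\epsilon$. Then $\partial_L=\mathbf d$ on $F_{Lie}\,\mathfrak g[1]$, i.e. $\partial_L(\epsilon(\alpha))=\epsilon(\mathbf d\alpha)$ for all $\alpha\in F_{Lie}\,\mathfrak g[1]$. As a result, $(F_{Lie}\,\mathfrak g[1],\mathbf d)$ is a subcomplex of the Loday complex $(\bar T\mathfrak g[1],\partial_L)$.
   Context: A (left) Leibniz algebra is a vector space $\mathfrak g$ with a bilinear bracket satisfying $[x_1,[x_2,x_3]]=[[x_1,x_2],x_3]+[x_2,[x_1,x_3]]$. $\mathfrak g[1]$ is $\mathfrak g$ placed in degree $-1$ (so its elements are odd), with the same bracket $[x,y]$. $\bar T\mathfrak g[1]=\bigoplus_{n\ge1}\mathfrak g[1]^{\otimes n}$, and the Loday complex is $\bar T\mathfrak g[1]$ with the boundary map $$\partial_L(x_1\otimes\cdots\otimes x_n)=\sum_{1\le i<j\le n}(-1)^{i-1}x_1\otimes\cdots\otimes\widehat{x_i}\otimes\cdots\otimes[x_i,x_j]\otimes x_{j+1}\otimes\cdots\otimes x_n,$$ where $\widehat{x_i}$ means omission and $[x_i,x_j]$ replaces $x_j$. $F_{Lie}\,\mathfrak g[1]=\bigoplus_{n\ge1}F^n_{Lie}\,\mathfrak g[1]$ is the free graded Lie algebra (Koszul signs) on $\mathfrak g[1]$, with bracket $(\cdot,\cdot)$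 and $n$ the bracket length. For $x_i\in\mathfrak g[1]$ put $\{x_1,\dots,x_n\}:=(x_1,(x_2,(\dots,x_n)))$; these right-normed brackets span $F^n_{Lie}\,\mathfrak g[1]$. The embedding $\epsilon:F_{Lie}\,\mathfrak g[1]\hookrightarrow\bar T\mathfrak g[1]$ is the graded commutator: $\epsilon\{x_1\}=x_1$ and $\epsilon\{x_1,\dots,x_n\}=x_1\otimes\epsilon\{x_2,\dots,x_n\}-(-1)^{n-1}\epsilon\{x_2,\dots,x_n\}\otimes x_1$. The map $\mathbf d$ on $F_{Lie}\,\mathfrak g[1]$ is $0$ on $F^1_{Lie}\,\mathfrak g[1]=\mathfrak g[1]$, and for $n\ge1$, $\mathbf d:F^{n+1}_{Lie}\,\mathfrak g[1]\to F^n_{Lie}\,\mathfrak g[1]$ is the (well-defined) linear map with $$\mathbf d\{x_1,\dots,x_{n+1}\}=\sum_{i<j,\ i\le n}(-1)^{i-1}\{x_1,\dots,\widehat{x_i},\dots,[x_i,x_j],x_{j+1},\dots,x_{n+1}\}+(-1)^{n-1}\{x_1,\dots,x_{n-1},[x_{n+1},x_n]\}.$$ *)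

theory Defs
  imports Complex_Main "HOL-Library.Poly_Mapping" "HOL-Library.FuncSet"
begin

section \<open>Leibniz algebras\<close>

locale leibniz_algebra = vector_space scale
  for scale :: "'k::field \<Rightarrow> 'v::ab_group_add \<Rightarrow> 'v" +
  fixes br :: "'v \<Rightarrow> 'v \<Rightarrow> 'v"
  assumes linear_right: "Vector_Spaces.linear scale scale (\<lambda>y. br x y)"
    and linear_left: "Vector_Spaces.linear scale scale (\<lambda>x. br x y)"
    and leibniz: "br x (br y z) = br (br x y) z + br y (br x z)"

section \<open>Free vector spaces and their quotients\<close>

text \<open>
  The free vector space on a type \<open>'x\<close> is \<open>'x \<Rightarrow>\<^sub>0 'k\<close>, with basis the elements
  \<open>Poly_Mapping.single x 1\<close>.
\<close>

definition fscale :: "'k::field \<Rightarrow> ('x \<Rightarrow>\<^sub>0 'k) \<Rightarrow> ('x \<Rightarrow>\<^sub>0 'k)" where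
  "fscale c p = Poly_Mapping.map (\<lambda>a. c * a) p"

lemma lookup_fscale: "Poly_Mapping.lookup (fscale c p) x = c * Poly_Mapping.lookup p x"
  by (simp add: fscale_def Poly_Mapping.map.rep_eq when_def)

lemma vector_space_fscale: "vector_space fscale"
  by unfold_locales
    (auto intro!: poly_mapping_eqI simp: lookup_fscale lookup_add algebra_simps)

definition linear_ext :: "('x \<Rightarrow> ('y \<Rightarrow>\<^sub>0 'k)) \<Rightarrow> ('x \<Rightarrow>\<^sub>0 'k::field) \<Rightarrow> ('y \<Rightarrow>\<^sub>0 'k)" where
  "linear_ext f p = (\<Sum>x\<in>Poly_Mapping.keys p. fscale (Poly_Mapping.lookup p x) (f x))"

definition bilinear_ext ::
    "('x \<Rightarrow> 'x \<Rightarrow> 'x) \<Rightarrow> ('x \<Rightarrow>\<^sub>0 'k::field) \<Rightarrow> ('x \<Rightarrow>\<^sub>0 'k) \<Rightarrow> ('x \<Rightarrow>\<^sub>0 'k)" where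
  "bilinear_ext m p q =
     (\<Sum>x\<in>Poly_Mapping.keys p. \<Sum>y\<in>Poly_Mapping.keys q.
        Poly_Mapping.single (m x y) (Poly_Mapping.lookup p x * Poly_Mapping.lookup q y))"

text \<open>
  A quotient of a free vector space by a subspace \<open>U\<close> depends on \<open>U\<close> and is therefore not a
  type; its elements are the cosets of \<open>U\<close>, and its operations are given on representatives.
\<close>

definition coset :: "('x \<Rightarrow>\<^sub>0 'k::field) set \<Rightarrow> ('x \<Rightarrow>\<^sub>0 'k) \<Rightarrow> ('x \<Rightarrow>\<^sub>0 'k) set" where
  "coset U p = {q. q - p \<in> U}"

definition quot_add ::
    "('x \<Rightarrow>\<^sub>0 'k::field) set \<Rightarrow> ('x \<Rightarrow>\<^sub>0 'k) set \<Rightarrow> ('x \<Rightarrow>\<^sub>0 'k) set \<Rightarrow> ('x \<Rightarrow>\<^sub>0 'k) set" where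
  "quot_add U A B = (\<Union>p\<in>A. \<Union>q\<in>B. coset U (p + q))"

definition quot_scale ::
    "('x \<Rightarrow>\<^sub>0 'k::field) set \<Rightarrow> 'k \<Rightarrow> ('x \<Rightarrow>\<^sub>0 'k) set \<Rightarrow> ('x \<Rightarrow>\<^sub>0 'k) set" where
  "quot_scale U c A = (\<Union>p\<in>A. coset U (fscale c p))"

text \<open>
  If \<open>f\<close> is linear and maps \<open>U\<close> into \<open>W\<close>, then \<open>quot_map W f\<close> is the induced map from the
  quotient by \<open>U\<close> to the quotient by \<open>W\<close>. (If \<open>f\<close> does not respect the cosets, the value is a
  union of several cosets, hence not an element of the target.)
\<close>

definition quot_map ::
    "('y \<Rightarrow>\<^sub>0 'k::field) set \<Rightarrow> (('x \<Rightarrow>\<^sub>0 'k) \<Rightarrow> ('y \<Rightarrow>\<^sub>0 'k)) \<Rightarrow> ('x \<Rightarrow>\<^sub>0 'k) set \<Rightarrow> ('y \<Rightarrow>\<^sub>0 'k) set"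
  where "quot_map W f A = (\<Union>p\<in>A. coset W (f p))"

definition quot_subspace :: "('x \<Rightarrow>\<^sub>0 'k::field) set \<Rightarrow> ('x \<Rightarrow>\<^sub>0 'k) set set \<Rightarrow> bool" where
  "quot_subspace U S \<longleftrightarrow>
     S \<subseteq> range (coset U) \<and> coset U 0 \<in> S \<and>
     (\<forall>A\<in>S. \<forall>B\<in>S. quot_add U A B \<in> S) \<and> (\<forall>c. \<forall>A\<in>S. quot_scale U c A \<in> S)"

definition quot_linear ::
    "('x \<Rightarrow>\<^sub>0 'k::field) set \<Rightarrow> ('x \<Rightarrow>\<^sub>0 'k) set set \<Rightarrow> ('y \<Rightarrow>\<^sub>0 'k) set \<Rightarrow> ('y \<Rightarrow>\<^sub>0 'k) set set
      \<Rightarrow> (('x \<Rightarrow>\<^sub>0 'k) set \<Rightarrow> ('y \<Rightarrow>\<^sub>0 'k) set) \<Rightarrow> bool" where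
  "quot_linear U S W T h \<longleftrightarrow>
     h ` S \<subseteq> T \<and>
     (\<forall>A\<in>S. \<forall>B\<in>S. h (quot_add U A B) = quot_add W (h A) (h B)) \<and>
     (\<forall>c. \<forall>A\<in>S. h (quot_scale U c A) = quot_scale W c (h A))"

text \<open>
  The subspace spanned by the classes of the basis elements whose length \<open>len\<close> satisfies \<open>P\<close>.
\<close>

definition length_part ::
    "('x \<Rightarrow>\<^sub>0 'k::field) set \<Rightarrow> ('x \<Rightarrow> nat) \<Rightarrow> (nat \<Rightarrow> bool) \<Rightarrow> ('x \<Rightarrow>\<^sub>0 'k) set set" where
  "length_part U len P = coset U ` {p. \<forall>x\<in>Poly_Mapping.keys p. P (len x)}"

section \<open>Complexes\<close>

text \<open>
  A complex concentrated in lengths \<open>n \<ge> 1\<close>: total space \<open>C\<close>, homogeneous parts \<open>G n\<close>, and a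
  differential \<open>D\<close> lowering the length by one.
\<close>

definition is_complex ::
    "('x \<Rightarrow>\<^sub>0 'k::field) set \<Rightarrow> ('x \<Rightarrow>\<^sub>0 'k) set set \<Rightarrow> (nat \<Rightarrow> ('x \<Rightarrow>\<^sub>0 'k) set set)
      \<Rightarrow> (('x \<Rightarrow>\<^sub>0 'k) set \<Rightarrow> ('x \<Rightarrow>\<^sub>0 'k) set) \<Rightarrow> bool" where
  "is_complex U C G D \<longleftrightarrow>
     quot_subspace U C \<and>
     (\<forall>n\<ge>1. quot_subspace U (G n) \<and> G n \<subseteq> C) \<and>
     quot_linear U C U C D \<and>
     D ` G 1 \<subseteq> {coset U 0} \<and>
     (\<forall>n\<ge>1. D ` G (Suc n) \<subseteq> G n) \<and>
     (\<forall>A\<in>C. D (D A) = coset U 0)"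

text \<open>
  The complex \<open>(C', G', D')\<close> is a subcomplex of \<open>(C, G, D)\<close> when \<open>C'\<close> is regarded as a subspace
  of \<open>C\<close> by means of the embedding \<open>e\<close>.
\<close>

definition is_subcomplex_via ::
    "('x \<Rightarrow>\<^sub>0 'k::field) set \<Rightarrow> ('x \<Rightarrow>\<^sub>0 'k) set set \<Rightarrow> (nat \<Rightarrow> ('x \<Rightarrow>\<^sub>0 'k) set set)
      \<Rightarrow> (('x \<Rightarrow>\<^sub>0 'k) set \<Rightarrow> ('x \<Rightarrow>\<^sub>0 'k) set)
      \<Rightarrow> ('y \<Rightarrow>\<^sub>0 'k) set \<Rightarrow> ('y \<Rightarrow>\<^sub>0 'k) set set \<Rightarrow> (nat \<Rightarrow> ('y \<Rightarrow>\<^sub>0 'k) set set)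
      \<Rightarrow> (('y \<Rightarrow>\<^sub>0 'k) set \<Rightarrow> ('y \<Rightarrow>\<^sub>0 'k) set)
      \<Rightarrow> (('x \<Rightarrow>\<^sub>0 'k) set \<Rightarrow> ('y \<Rightarrow>\<^sub>0 'k) set) \<Rightarrow> bool" where
  "is_subcomplex_via U' C' G' D' U C G D e \<longleftrightarrow>
     is_complex U' C' G' D' \<and> is_complex U C G D \<and>
     quot_linear U' C' U C e \<and> inj_on e C' \<and>
     (\<forall>n\<ge>1. e ` G' n \<subseteq> G n) \<and>
     (\<forall>A\<in>C'. D (e A) = e (D' A))"

section \<open>The tensor space and the Loday complex\<close>

text \<open>
  The list \<open>[x\<^sub>1, \<dots>, x\<^sub>n]\<close> stands for \<open>x\<^sub>1 \<otimes> \<dots> \<otimes> x\<^sub>n\<close>. All elements of \<open>\<gg>[1]\<close> have degree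
  \<open>-1\<close>, so the parity of a tensor or of an iterated bracket is the parity of its length.
\<close>

inductive_set tensor_relators ::
    "('k::field \<Rightarrow> 'v::ab_group_add \<Rightarrow> 'v) \<Rightarrow> ('v list \<Rightarrow>\<^sub>0 'k) set"
  for scale :: "'k \<Rightarrow> 'v \<Rightarrow> 'v" where
  tensor_add:
    "Poly_Mapping.single (xs @ [a + b] @ ys) 1
      - Poly_Mapping.single (xs @ [a] @ ys) 1 - Poly_Mapping.single (xs @ [b] @ ys) 1
      \<in> tensor_relators scale"
| tensor_scale:
    "Poly_Mapping.single (xs @ [scale c a] @ ys) 1 - Poly_Mapping.single (xs @ [a] @ ys) c
      \<in> tensor_relators scale"

definition tensor_rel ::
    "('k::field \<Rightarrow> 'v::ab_group_add \<Rightarrow> 'v) \<Rightarrow> ('v list \<Rightarrow>\<^sub>0 'k) set" where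
  "tensor_rel scale = module.span fscale (tensor_relators scale)"

definition tensor_bar ::
    "('k::field \<Rightarrow> 'v::ab_group_add \<Rightarrow> 'v) \<Rightarrow> ('v list \<Rightarrow>\<^sub>0 'k) set set" where
  "tensor_bar scale = length_part (tensor_rel scale) length (\<lambda>n. n \<ge> 1)"

definition tensor_power ::
    "('k::field \<Rightarrow> 'v::ab_group_add \<Rightarrow> 'v) \<Rightarrow> nat \<Rightarrow> ('v list \<Rightarrow>\<^sub>0 'k) set set" where
  "tensor_power scale n = length_part (tensor_rel scale) length (\<lambda>m. m = n)"

text \<open>
  With positions counted from 0: replace \<open>x\<^sub>j\<close> by \<open>[x\<^sub>i, x\<^sub>j]\<close> and omit \<open>x\<^sub>i\<close>. The sign
  \<open>(-1)\<^sup>i\<^sup>-\<^sup>1\<close> for positions counted from 1 becomes \<open>(-1)\<^sup>i\<close>.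
\<close>

definition contract :: "('v \<Rightarrow> 'v \<Rightarrow> 'v) \<Rightarrow> nat \<Rightarrow> nat \<Rightarrow> 'v list \<Rightarrow> 'v list" where
  "contract br i j xs =
     (let ys = xs[j := br (xs ! i) (xs ! j)] in take i ys @ drop (Suc i) ys)"

definition loday_word :: "('v \<Rightarrow> 'v \<Rightarrow> 'v) \<Rightarrow> 'v list \<Rightarrow> ('v list \<Rightarrow>\<^sub>0 'k::field)" where
  "loday_word br xs =
     (\<Sum>j<length xs. \<Sum>i<j. Poly_Mapping.single (contract br i j xs) ((-1) ^ i))"

definition loday_boundary ::
    "('k::field \<Rightarrow> 'v::ab_group_add \<Rightarrow> 'v) \<Rightarrow> ('v \<Rightarrow> 'v \<Rightarrow> 'v)
      \<Rightarrow> ('v list \<Rightarrow>\<^sub>0 'k) set \<Rightarrow> ('v list \<Rightarrow>\<^sub>0 'k) set" where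
  "loday_boundary scale br = quot_map (tensor_rel scale) (linear_ext (loday_word br))"

section \<open>The free graded Lie algebra\<close>

text \<open>
  The free graded Lie algebra is the quotient of the free nonassociative algebra on the
  elements of \<open>\<gg>\<close> by the two-sided ideal generated by linearity in the generators, graded
  antisymmetry and the graded Jacobi identity (with Koszul signs).
\<close>

datatype 'v bracket_word = Gen 'v | Br "'v bracket_word" "'v bracket_word"

primrec bracket_length :: "'v bracket_word \<Rightarrow> nat" where
  "bracket_length (Gen x) = 1"
| "bracket_length (Br a b) = bracket_length a + bracket_length b"

abbreviation koszul :: "'v bracket_word \<Rightarrow> 'v bracket_word \<Rightarrow> 'k::field" where
  "koszul a b \<equiv> (-1) ^ (bracket_length a * bracket_length b)"

inductive_set lie_relators ::
    "('k::field \<Rightarrow> 'v::ab_group_add \<Rightarrow> 'v) \<Rightarrow> ('v bracket_word \<Rightarrow>\<^sub>0 'k) set"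
  for scale :: "'k \<Rightarrow> 'v \<Rightarrow> 'v" where
  gen_add:
    "Poly_Mapping.single (Gen (x + y)) 1
      - Poly_Mapping.single (Gen x) 1 - Poly_Mapping.single (Gen y) 1 \<in> lie_relators scale"
| gen_scale:
    "Poly_Mapping.single (Gen (scale c x)) 1 - Poly_Mapping.single (Gen x) c
      \<in> lie_relators scale"
| antisym:
    "Poly_Mapping.single (Br a b) 1 + Poly_Mapping.single (Br b a) (koszul a b)
      \<in> lie_relators scale"
| jacobi:
    "Poly_Mapping.single (Br a (Br b c)) 1 - Poly_Mapping.single (Br (Br a b) c) 1
      - Poly_Mapping.single (Br b (Br a c)) (koszul a b) \<in> lie_relators scale"
| ideal_left:
    "r \<in> lie_relators scale \<Longrightarrow>
      bilinear_ext Br (Poly_Mapping.single w 1) r \<in> lie_relators scale"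
| ideal_right:
    "r \<in> lie_relators scale \<Longrightarrow>
      bilinear_ext Br r (Poly_Mapping.single w 1) \<in> lie_relators scale"

definition lie_rel ::
    "('k::field \<Rightarrow> 'v::ab_group_add \<Rightarrow> 'v) \<Rightarrow> ('v bracket_word \<Rightarrow>\<^sub>0 'k) set" where
  "lie_rel scale = module.span fscale (lie_relators scale)"

definition free_lie ::
    "('k::field \<Rightarrow> 'v::ab_group_add \<Rightarrow> 'v) \<Rightarrow> ('v bracket_word \<Rightarrow>\<^sub>0 'k) set set" where
  "free_lie scale = range (coset (lie_rel scale))"

definition free_lie_part ::
    "('k::field \<Rightarrow> 'v::ab_group_add \<Rightarrow> 'v) \<Rightarrow> nat \<Rightarrow> ('v bracket_word \<Rightarrow>\<^sub>0 'k) set set" where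
  "free_lie_part scale n = length_part (lie_rel scale) bracket_length (\<lambda>m. m = n)"

text \<open>The embedding \<open>\<epsilon>\<close>: brackets become graded commutators of tensors.\<close>

primrec commutator_word :: "'v bracket_word \<Rightarrow> ('v list \<Rightarrow>\<^sub>0 'k::field)" where
  "commutator_word (Gen x) = Poly_Mapping.single [x] 1"
| "commutator_word (Br a b) =
     bilinear_ext (@) (commutator_word a) (commutator_word b)
     - fscale (koszul a b) (bilinear_ext (@) (commutator_word b) (commutator_word a))"

definition lie_embedding ::
    "('k::field \<Rightarrow> 'v::ab_group_add \<Rightarrow> 'v)
      \<Rightarrow> ('v bracket_word \<Rightarrow>\<^sub>0 'k) set \<Rightarrow> ('v list \<Rightarrow>\<^sub>0 'k) set" where
  "lie_embedding scale = quot_map (tensor_rel scale) (linear_ext commutator_word)"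

text \<open>The right-normed bracket \<open>{x\<^sub>1, \<dots>, x\<^sub>n}\<close>, for \<open>n \<ge> 1\<close>.\<close>

fun right_normed :: "'v list \<Rightarrow> 'v bracket_word" where
  "right_normed [x] = Gen x"
| "right_normed (x # y # ys) = Br (Gen x) (right_normed (y # ys))"

lemma bracket_length_right_normed:
  "xs \<noteq> [] \<Longrightarrow> bracket_length (right_normed xs) = length xs"
  by (induction xs rule: right_normed.induct) auto

lemma commutator_word_right_normed:
  assumes "xs \<noteq> []"
  shows "commutator_word (right_normed (x # xs)) =
    bilinear_ext (@) (Poly_Mapping.single [x] 1) (commutator_word (right_normed xs))
    - fscale ((-1) ^ length xs)
        (bilinear_ext (@) (commutator_word (right_normed xs)) (Poly_Mapping.single [x] 1))"
  using assms by (cases xs) (auto simp: bracket_length_right_normed)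

definition lie_boundary_word :: "('v \<Rightarrow> 'v \<Rightarrow> 'v) \<Rightarrow> 'v list \<Rightarrow> ('v bracket_word \<Rightarrow>\<^sub>0 'k::field)"
  where
  "lie_boundary_word br xs =
     (let m = length xs in
       (\<Sum>j<m. \<Sum>i<j. Poly_Mapping.single (right_normed (contract br i j xs)) ((-1) ^ i))
       + Poly_Mapping.single
           (right_normed (take (m - 2) xs @ [br (xs ! (m - 1)) (xs ! (m - 2))])) ((-1) ^ (m - 2)))"

definition is_lie_boundary ::
    "('k::field \<Rightarrow> 'v::ab_group_add \<Rightarrow> 'v) \<Rightarrow> ('v \<Rightarrow> 'v \<Rightarrow> 'v)
      \<Rightarrow> (('v bracket_word \<Rightarrow>\<^sub>0 'k) set \<Rightarrow> ('v bracket_word \<Rightarrow>\<^sub>0 'k) set) \<Rightarrow> bool" where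
  "is_lie_boundary scale br d \<longleftrightarrow>
     d \<in> extensional (free_lie scale) \<and>
     quot_linear (lie_rel scale) (free_lie scale) (lie_rel scale) (free_lie scale) d \<and>
     (\<forall>A\<in>free_lie_part scale 1. d A = coset (lie_rel scale) 0) \<and>
     (\<forall>xs. length xs \<ge> 2 \<longrightarrow>
        d (coset (lie_rel scale) (Poly_Mapping.single (right_normed xs) 1))
          = coset (lie_rel scale) (lie_boundary_word br xs))"

text \<open>
  The map \<open>\<d>\<close>. It is unique because the right-normed brackets span the free Lie algebra;
  \<open>extensional\<close> only fixes the irrelevant values outside the carrier.
\<close>

definition lie_boundary ::
    "('k::field \<Rightarrow> 'v::ab_group_add \<Rightarrow> 'v) \<Rightarrow> ('v \<Rightarrow> 'v \<Rightarrow> 'v)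
      \<Rightarrow> ('v bracket_word \<Rightarrow>\<^sub>0 'k) set \<Rightarrow> ('v bracket_word \<Rightarrow>\<^sub>0 'k) set" where
  "lie_boundary scale br = (THE d. is_lie_boundary scale br d)"

end

theory Submission
  imports Defs
begin

text \<open>
  On right-normed brackets the identity already holds in the free vector space on words: the Loday
  boundary satisfies \<open>\<partial>(x \<otimes> w) = L\<^sub>x w - x \<otimes> \<partial>w\<close> with \<open>L\<^sub>x\<close> the derivation extending \<open>[x, -]\<close>,
  while \<open>\<partial>(w \<otimes> x)\<close> differs from \<open>\<partial>w \<otimes> x\<close> by an odd contraction of \<open>w\<close>, and odd contractions
  vanish on commutators of length at least two. The Dynkin map \<open>x\<^sub>1 \<otimes> \<dots> \<otimes> x\<^sub>n \<mapsto> {x\<^sub>1, \<dots>, x\<^sub>n} / n\<close> is a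
  left inverse of \<open>\<epsilon>\<close> in characteristic 0. Hence \<open>\<epsilon>\<close> is injective and the right-normed brackets
  span, so \<open>\<d>\<close> is well defined as the restriction of \<open>\<partial>\<close>, and its square vanishes because that of
  \<open>\<partial>\<close> does.
\<close>

section \<open>Linear maps between free vector spaces\<close>

interpretation fs: vector_space fscale
  by (rule vector_space_fscale)

abbreviation lin :: "(('x \<Rightarrow>\<^sub>0 'k::field) \<Rightarrow> ('y \<Rightarrow>\<^sub>0 'k)) \<Rightarrow> bool" where
  "lin \<equiv> Vector_Spaces.linear fscale fscale"

lemma linI:
  assumes "\<And>p q. f (p + q) = f p + f q" "\<And>c p. f (fscale c p) = fscale c (f p)"
  shows "lin f"
  by (rule Vector_Spaces.linear.intro[OF vector_space_fscale vector_space_fscale])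
    (unfold_locales, auto simp: assms)

lemma lin_add: "lin f \<Longrightarrow> f (p + q) = f p + f q"
  by (simp add: linear_iff_module_hom module_hom.add)

lemma lin_fscale: "lin f \<Longrightarrow> f (fscale c p) = fscale c (f p)"
  by (simp add: linear_iff_module_hom module_hom.scale)

lemma lin_diff: "lin f \<Longrightarrow> f (p - q) = f p - f q"
  by (simp add: linear_iff_module_hom module_hom.diff)

lemma lin_minus: "lin f \<Longrightarrow> f (- p) = - f p"
  by (simp add: linear_iff_module_hom module_hom.neg)

lemma lin_zero: "lin f \<Longrightarrow> f 0 = 0"
  by (simp add: linear_iff_module_hom module_hom.zero)

lemma lin_sum: "lin f \<Longrightarrow> f (\<Sum>i\<in>I. g i) = (\<Sum>i\<in>I. f (g i))"
  by (simp add: linear_iff_module_hom module_hom.sum)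

lemma lin_compose: "lin f \<Longrightarrow> lin g \<Longrightarrow> lin (\<lambda>p. f (g p))"
  by (rule linI) (simp_all add: lin_add lin_fscale)

lemma fscale_single [simp]: "fscale c (Poly_Mapping.single x d) = Poly_Mapping.single x (c * d)"
  by (rule poly_mapping_eqI) (simp add: lookup_fscale lookup_single when_def)

lemma keys_fscale: "Poly_Mapping.keys (fscale c p) \<subseteq> Poly_Mapping.keys p"
  by (auto simp: in_keys_iff lookup_fscale)

lemma fscale_minus_one [simp]: "fscale (- 1) p = - p"
  by (rule poly_mapping_eqI) (simp add: lookup_fscale)

text \<open>Keys can cancel in a sum, so additivity of \<open>linear_ext\<close> needs one finite
  index set that serves \<open>p\<close>, \<open>q\<close> and \<open>p + q\<close> alike.\<close>

lemma linear_ext_superset: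
  assumes "finite S" "Poly_Mapping.keys p \<subseteq> S"
  shows "linear_ext f p = (\<Sum>x\<in>S. fscale (Poly_Mapping.lookup p x) (f x))"
  unfolding linear_ext_def
  by (rule sum.mono_neutral_left) (use assms in \<open>auto simp: in_keys_iff\<close>)

lemma lin_linear_ext [intro, simp]:
  fixes f :: "'x \<Rightarrow> ('y \<Rightarrow>\<^sub>0 'k::field)"
  shows "lin (linear_ext f)"
proof (rule linI)
  fix p q :: "'x \<Rightarrow>\<^sub>0 'k"
  let ?S = "Poly_Mapping.keys p \<union> Poly_Mapping.keys q"
  have "Poly_Mapping.keys (p + q) \<subseteq> ?S" by (rule Poly_Mapping.keys_add)
  then show "linear_ext f (p + q) = linear_ext f p + linear_ext f q"
    by (simp add: linear_ext_superset[of ?S] lookup_add fs.scale_left_distrib sum.distrib)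
next
  fix c and p :: "'x \<Rightarrow>\<^sub>0 'k"
  show "linear_ext f (fscale c p) = fscale c (linear_ext f p)"
    using keys_fscale[of c p]
    by (simp add: linear_ext_superset[of "Poly_Mapping.keys p"] lookup_fscale fs.scale_sum_right)
qed

lemma linear_ext_single [simp]: "linear_ext f (Poly_Mapping.single x c) = fscale c (f x)"
  by (cases "c = 0") (simp_all add: linear_ext_def)

lemmas linear_ext_simps [simp] =
  lin_add[OF lin_linear_ext] lin_diff[OF lin_linear_ext] lin_fscale[OF lin_linear_ext]
  lin_zero[OF lin_linear_ext] lin_minus[OF lin_linear_ext]

lemma linear_ext_cong:
  "(\<And>x. x \<in> Poly_Mapping.keys p \<Longrightarrow> f x = g x) \<Longrightarrow> linear_ext f p = linear_ext g p"
  by (simp add: linear_ext_def)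

lemma linear_ext_add_fun: "linear_ext (\<lambda>x. f x + g x) p = linear_ext f p + linear_ext g p"
  by (simp add: linear_ext_def fs.scale_right_distrib sum.distrib)

lemma linear_ext_fscale_fun: "linear_ext (\<lambda>x. fscale c (f x)) p = fscale c (linear_ext f p)"
  by (simp add: linear_ext_def fs.scale_sum_right mult.commute)

lemma linear_ext_id: "linear_ext (\<lambda>x. Poly_Mapping.single x 1) p = p"
proof (rule poly_mapping_eqI)
  fix y
  have "Poly_Mapping.lookup (linear_ext (\<lambda>x. Poly_Mapping.single x 1) p) y =
    (\<Sum>x\<in>Poly_Mapping.keys p. if x = y then Poly_Mapping.lookup p x else 0)"
    by (simp add: linear_ext_def lookup_sum lookup_single when_def cong: if_cong)
  then show "Poly_Mapping.lookup (linear_ext (\<lambda>x. Poly_Mapping.single x 1) p) y = Poly_Mapping.lookup p y"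
    by (simp add: in_keys_iff)
qed

lemma lin_eq_linear_ext:
  assumes "lin f"
  shows "f p = linear_ext (\<lambda>x. f (Poly_Mapping.single x 1)) p"
proof -
  have "f p = f (linear_ext (\<lambda>x. Poly_Mapping.single x 1) p)" by (simp only: linear_ext_id)
  also have "\<dots> = linear_ext (\<lambda>x. f (Poly_Mapping.single x 1)) p"
    unfolding linear_ext_def by (simp only: lin_sum[OF assms] lin_fscale[OF assms])
  finally show ?thesis .
qed

lemma linear_ext_in_subspace:
  assumes "fs.subspace U" "\<And>x. x \<in> Poly_Mapping.keys p \<Longrightarrow> f x \<in> U"
  shows "linear_ext f p \<in> U"
  unfolding linear_ext_def
  by (intro fs.subspace_sum[OF assms(1)] fs.subspace_scale[OF assms(1)] assms(2))

text \<open>Testing only the keys of \<open>p\<close> rather than all basis elements lets a support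
  hypothesis on \<open>p\<close>, such as homogeneity, enter the check on words.\<close>

lemma lin_eqI:
  assumes "lin f" "lin g"
    and "\<And>x. x \<in> Poly_Mapping.keys p \<Longrightarrow> f (Poly_Mapping.single x 1) = g (Poly_Mapping.single x 1)"
  shows "f p = g p"
  by (subst lin_eq_linear_ext[OF assms(1)], subst lin_eq_linear_ext[OF assms(2)])
    (rule linear_ext_cong[OF assms(3)])

lemma lin_diffI:
  assumes "lin f" "lin g" "fs.subspace U"
    and "\<And>x. x \<in> Poly_Mapping.keys p \<Longrightarrow> f (Poly_Mapping.single x 1) - g (Poly_Mapping.single x 1) \<in> U"
  shows "f p - g p \<in> U"
proof -
  have l: "lin (\<lambda>p. f p - g p)"
    by (rule linI)
      (simp_all add: lin_add lin_fscale assms(1,2) fs.scale_right_diff_distrib)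
  show ?thesis
    by (subst lin_eq_linear_ext[OF l]) (rule linear_ext_in_subspace[OF assms(3,4)])
qed

lemma lin_mem_span:
  assumes "lin f" "fs.subspace U" "\<And>r. r \<in> R \<Longrightarrow> f r \<in> U" "p \<in> fs.span R"
  shows "f p \<in> U"
  using assms(4)
proof (rule fs.span_induct)
  show "fs.subspace {p. f p \<in> U}"
    using assms(1,2)
    by (auto simp: fs.subspace_def lin_zero lin_add lin_fscale)
qed (rule assms(3))

section \<open>Spans of words with a given property\<close>

definition supported :: "('x \<Rightarrow> bool) \<Rightarrow> ('x \<Rightarrow>\<^sub>0 'k::field) set" where
  "supported P = {p. \<forall>x\<in>Poly_Mapping.keys p. P x}"

lemma subspace_supported: "fs.subspace (supported P)"
  unfolding fs.subspace_def supported_def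
  using Poly_Mapping.keys_add keys_fscale by (fastforce simp: subset_iff)

lemma single_in_supported: "P x \<Longrightarrow> Poly_Mapping.single x c \<in> supported P"
  by (simp add: supported_def)

lemma supportedD: "p \<in> supported P \<Longrightarrow> x \<in> Poly_Mapping.keys p \<Longrightarrow> P x"
  by (simp add: supported_def)

lemma linear_ext_supported:
  assumes "p \<in> supported P" "\<And>x. P x \<Longrightarrow> f x \<in> supported Q"
  shows "linear_ext f p \<in> supported Q"
  using linear_ext_in_subspace[OF subspace_supported] assms by (metis supportedD)

section \<open>Bilinear extensions\<close>

lemma bilinear_ext_eq:
  "bilinear_ext m p q = linear_ext (\<lambda>x. linear_ext (\<lambda>y. Poly_Mapping.single (m x y) 1) q) p"
  by (simp add: bilinear_ext_def linear_ext_def fs.scale_sum_right)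

lemma lin_linear_ext_param:
  assumes "\<And>x. lin (F x)"
  shows "lin (\<lambda>q. linear_ext (\<lambda>x. F x q) p)"
  by (rule linI)
    (simp_all add: lin_add[OF assms] lin_fscale[OF assms] linear_ext_add_fun linear_ext_fscale_fun)

lemma lin_bilinear_ext_left: "lin (\<lambda>p. bilinear_ext m p q)"
  unfolding bilinear_ext_eq by (rule lin_linear_ext)

lemma lin_bilinear_ext_right: "lin (bilinear_ext m p)"
  unfolding bilinear_ext_eq by (rule lin_linear_ext_param) (rule lin_linear_ext)

lemmas bilinear_ext_simps [simp] =
  lin_add[OF lin_bilinear_ext_left] lin_diff[OF lin_bilinear_ext_left]
  lin_fscale[OF lin_bilinear_ext_left] lin_zero[OF lin_bilinear_ext_left]
  lin_minus[OF lin_bilinear_ext_left] lin_minus[OF lin_bilinear_ext_right]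
  lin_add[OF lin_bilinear_ext_right] lin_diff[OF lin_bilinear_ext_right]
  lin_fscale[OF lin_bilinear_ext_right] lin_zero[OF lin_bilinear_ext_right]

lemma bilinear_ext_single [simp]:
  "bilinear_ext m (Poly_Mapping.single x c) (Poly_Mapping.single y d) = Poly_Mapping.single (m x y) (c * d)"
  by (simp add: bilinear_ext_eq)

lemma bilinear_ext_supported:
  assumes "p \<in> supported P" "q \<in> supported Q" "\<And>x y. P x \<Longrightarrow> Q y \<Longrightarrow> R (m x y)"
  shows "bilinear_ext m p q \<in> supported R"
  unfolding bilinear_ext_eq
  by (intro linear_ext_supported[OF assms(1)] linear_ext_supported[OF assms(2)]
      single_in_supported assms(3))

lemma bilinear_ext_append_assoc:
  "bilinear_ext (@) (bilinear_ext (@) p q) r = bilinear_ext (@) p (bilinear_ext (@) q r)"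
proof (rule lin_eqI[where p = p])
  fix x
  show "bilinear_ext (@) (bilinear_ext (@) (Poly_Mapping.single x 1) q) r
    = bilinear_ext (@) (Poly_Mapping.single x 1) (bilinear_ext (@) q r)"
  proof (rule lin_eqI[where p = q])
    fix y
    show "bilinear_ext (@) (bilinear_ext (@) (Poly_Mapping.single x 1) (Poly_Mapping.single y 1)) r
      = bilinear_ext (@) (Poly_Mapping.single x 1) (bilinear_ext (@) (Poly_Mapping.single y 1) r)"
      by (rule lin_eqI[where p = r]) ((rule linI; simp)+, simp)
  qed (rule linI; simp)+
qed (rule linI; simp)+

section \<open>Quotients\<close>

lemma coset_eq_iff: "fs.subspace U \<Longrightarrow> coset U p = coset U q \<longleftrightarrow> p - q \<in> U"
proof
  assume U: "fs.subspace U" and "coset U p = coset U q"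
  moreover have "p \<in> coset U p" using fs.subspace_0[OF U] by (simp add: coset_def)
  ultimately show "p - q \<in> U" by (simp add: coset_def)
next
  assume U: "fs.subspace U" and pq: "p - q \<in> U"
  have "r - q \<in> U \<longleftrightarrow> r - p \<in> U" for r
    using fs.subspace_add[OF U _ pq, of "r - p"] fs.subspace_diff[OF U _ pq, of "r - q"] by auto
  then show "coset U p = coset U q" by (auto simp: coset_def)
qed

lemma mem_coset: "r \<in> coset U p \<longleftrightarrow> r - p \<in> U"
  by (simp add: coset_def)

text \<open>All representatives of a coset have their images in one coset of \<open>W\<close>, so
  the union in \<open>quot_map\<close> collapses.\<close>

lemma quot_map_coset:
  assumes "fs.subspace U" "fs.subspace W" "lin f" "\<And>p. p \<in> U \<Longrightarrow> f p \<in> W"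
  shows "quot_map W f (coset U p) = coset W (f p)"
proof -
  have "coset W (f q) = coset W (f p)" if "q \<in> coset U p" for q
    using that assms(4)[of "q - p"] by (simp add: coset_eq_iff assms(2) mem_coset lin_diff[OF assms(3)])
  moreover have "p \<in> coset U p" using fs.subspace_0[OF assms(1)] by (simp add: mem_coset)
  ultimately show ?thesis unfolding quot_map_def by blast
qed

lemma quot_scale_coset:
  assumes "fs.subspace U"
  shows "quot_scale U c (coset U p) = coset U (fscale c p)"
  using quot_map_coset[OF assms assms, of "fscale c" p] fs.subspace_scale[OF assms]
  by (simp add: quot_map_def quot_scale_def linI fs.scale_right_distrib mult.commute)

lemma quot_add_coset:
  assumes "fs.subspace U"
  shows "quot_add U (coset U p) (coset U q) = coset U (p + q)"
proof -
  have "coset U (p' + q') = coset U (p + q)" if "p' \<in> coset U p" "q' \<in> coset U q" for p' q'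
    using fs.subspace_add[OF assms, of "p' - p" "q' - q"] that
    by (simp add: coset_eq_iff assms mem_coset algebra_simps)
  moreover have "p \<in> coset U p" "q \<in> coset U q"
    using fs.subspace_0[OF assms] by (simp_all add: mem_coset)
  ultimately show ?thesis unfolding quot_add_def by blast
qed

lemma quot_subspace_image:
  assumes U: "fs.subspace U" and S: "fs.subspace S"
  shows "quot_subspace U (coset U ` S)"
  unfolding quot_subspace_def
  using fs.subspace_0[OF S] fs.subspace_add[OF S] fs.subspace_scale[OF S]
  by (auto simp: quot_add_coset[OF U] quot_scale_coset[OF U])

lemma quot_linear_image:
  assumes U: "fs.subspace U" and W: "fs.subspace W" and S: "fs.subspace S" and f: "lin f"
    and h: "\<And>p. p \<in> S \<Longrightarrow> h (coset U p) = coset W (f p)"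
    and ST: "\<And>p. p \<in> S \<Longrightarrow> f p \<in> T"
  shows "quot_linear U (coset U ` S) W (coset W ` T) h"
  unfolding quot_linear_def
  using fs.subspace_add[OF S] fs.subspace_scale[OF S] ST
  by (auto simp: h quot_add_coset[OF U] quot_scale_coset[OF U] quot_add_coset[OF W]
      quot_scale_coset[OF W] lin_add[OF f] lin_fscale[OF f])

lemma length_part_eq: "length_part U len P = coset U ` supported (\<lambda>x. P (len x))"
  by (simp add: length_part_def supported_def)

abbreviation tensor_prod :: "('v list \<Rightarrow>\<^sub>0 'k::field) \<Rightarrow> ('v list \<Rightarrow>\<^sub>0 'k) \<Rightarrow> ('v list \<Rightarrow>\<^sub>0 'k)"
    (infixl "\<odot>" 75) where
  "p \<odot> q \<equiv> bilinear_ext (@) p q"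

lemmas tensor_prod_assoc = bilinear_ext_append_assoc

section \<open>Linearity modulo a subspace\<close>

text \<open>The basis word of a sum of vectors is not the sum of their basis words, so maps that
  read letters are linear only modulo relations. Multilinearity of a map on words is checked in this
  form, one letter at a time.\<close>

definition linear_mod ::
    "('k::field \<Rightarrow> 'v::ab_group_add \<Rightarrow> 'v) \<Rightarrow> ('x \<Rightarrow>\<^sub>0 'k) set \<Rightarrow> ('v \<Rightarrow> ('x \<Rightarrow>\<^sub>0 'k)) \<Rightarrow> bool" where
  "linear_mod scale U f \<longleftrightarrow>
     (\<forall>a b. f (a + b) - f a - f b \<in> U) \<and> (\<forall>c a. f (scale c a) - fscale c (f a) \<in> U)"

lemma linear_mod_zero: "fs.subspace U \<Longrightarrow> linear_mod scale U (\<lambda>a. 0)"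
  by (simp add: linear_mod_def fs.subspace_0)

lemma linear_mod_add:
  assumes "fs.subspace U" "linear_mod scale U f" "linear_mod scale U g"
  shows "linear_mod scale U (\<lambda>a. f a + g a)"
  unfolding linear_mod_def
proof (intro conjI allI)
  fix a b
  have "(f (a + b) - f a - f b) + (g (a + b) - g a - g b) \<in> U"
    using assms by (simp add: linear_mod_def fs.subspace_add)
  then show "f (a + b) + g (a + b) - (f a + g a) - (f b + g b) \<in> U"
    by (simp add: algebra_simps)
next
  fix c a
  have "(f (scale c a) - fscale c (f a)) + (g (scale c a) - fscale c (g a)) \<in> U"
    using assms by (simp add: linear_mod_def fs.subspace_add)
  then show "f (scale c a) + g (scale c a) - fscale c (f a + g a) \<in> U"
    by (simp add: fs.scale_right_distrib algebra_simps)
qed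

lemma linear_mod_compose:
  assumes "linear_mod scale U f" "lin F" "\<And>p. p \<in> U \<Longrightarrow> F p \<in> W"
  shows "linear_mod scale W (\<lambda>a. F (f a))"
  using assms(1) assms(3)[of "f (a + b) - f a - f b" for a b] assms(3)[of "f (scale c a) - fscale c (f a)" for c a]
  by (simp add: linear_mod_def lin_diff[OF assms(2)] lin_fscale[OF assms(2)])

lemma linear_mod_diff:
  assumes "fs.subspace U" "linear_mod scale U f" "linear_mod scale U g"
  shows "linear_mod scale U (\<lambda>a. f a - g a)"
  using linear_mod_add[OF assms(1,2) linear_mod_compose[OF assms(3), of uminus U]]
    fs.subspace_neg[OF assms(1)]
  by (simp add: linI fs.scale_minus_right)

lemma linear_mod_precompose:
  assumes "linear_mod scale U f" "Vector_Spaces.linear scale scale g"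
  shows "linear_mod scale U (\<lambda>a. f (g a))"
  using assms by (simp add: linear_mod_def linear_iff_module_hom module_hom.add module_hom.scale)

section \<open>The tensor relations form a two-sided ideal\<close>

lemma subspace_tensor_rel: "fs.subspace (tensor_rel scale)"
  by (simp add: tensor_rel_def)

lemma linear_mod_tensor_rel:
  "linear_mod scale (tensor_rel scale) (\<lambda>a. Poly_Mapping.single (xs @ [a] @ ys) 1)"
  unfolding linear_mod_def tensor_rel_def
  using tensor_add[where xs = xs and ys = ys and scale = scale]
    tensor_scale[where xs = xs and ys = ys and scale = scale]
  by (auto intro: fs.span_base)

text \<open>The relators express additivity and homogeneity in one letter, so this is the universal
  property of the tensor powers. Products, signs, the normalized Dynkin map and the Loday boundary
  descend by it.\<close>

lemma tensor_rel_image: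
  assumes "lin F" "fs.subspace U"
    and "\<And>xs ys. linear_mod scale U (\<lambda>a. F (Poly_Mapping.single (xs @ [a] @ ys) 1))"
    and "p \<in> tensor_rel scale"
  shows "F p \<in> U"
  using assms(1,2) _ assms(4)[unfolded tensor_rel_def]
proof (rule lin_mem_span)
  fix r assume "r \<in> tensor_relators scale"
  then show "F r \<in> U"
  proof cases
    case (tensor_add xs a b ys)
    then show ?thesis
      using assms(3)[of xs ys] by (simp add: linear_mod_def lin_diff[OF assms(1)])
  next
    case (tensor_scale xs c a ys)
    \<comment> \<open>The relator holds the scalar as a coefficient, whereas
      \<open>linear_mod\<close> needs it as a scalar multiple of the basis word.\<close>
    have "Poly_Mapping.single (xs @ [a] @ ys) c = fscale c (Poly_Mapping.single (xs @ [a] @ ys) 1)"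
      by simp
    then show ?thesis
      using assms(3)[of xs ys] tensor_scale
      by (simp only: linear_mod_def lin_diff[OF assms(1)] lin_fscale[OF assms(1)])
  qed
qed

text \<open>Linearity reduces \<open>q\<close> to a single word \<open>zs\<close>, and multiplying
  by it only lengthens the prefix of a relator.\<close>

lemma tensor_rel_prod_left:
  assumes "p \<in> tensor_rel scale"
  shows "q \<odot> p \<in> tensor_rel scale"
proof (subst lin_eq_linear_ext[OF lin_bilinear_ext_left], rule linear_ext_in_subspace[OF subspace_tensor_rel])
  fix zs
  show "Poly_Mapping.single zs 1 \<odot> p \<in> tensor_rel scale"
    using lin_bilinear_ext_right subspace_tensor_rel _ assms
  proof (rule tensor_rel_image)
    show "linear_mod scale (tensor_rel scale)
        (\<lambda>a. Poly_Mapping.single zs 1 \<odot> Poly_Mapping.single (xs @ [a] @ ys) 1)" for xs ys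
      using linear_mod_tensor_rel[of scale "zs @ xs" ys] by simp
  qed
qed

lemma tensor_rel_prod_right:
  assumes "p \<in> tensor_rel scale"
  shows "p \<odot> q \<in> tensor_rel scale"
proof (subst lin_eq_linear_ext[OF lin_bilinear_ext_right], rule linear_ext_in_subspace[OF subspace_tensor_rel])
  fix zs
  show "p \<odot> Poly_Mapping.single zs 1 \<in> tensor_rel scale"
    using lin_bilinear_ext_left subspace_tensor_rel _ assms
  proof (rule tensor_rel_image)
    show "linear_mod scale (tensor_rel scale)
        (\<lambda>a. Poly_Mapping.single (xs @ [a] @ ys) 1 \<odot> Poly_Mapping.single zs 1)" for xs ys
      using linear_mod_tensor_rel[of scale xs "ys @ zs"] by simp
  qed
qed

section \<open>The graded commutator embedding\<close>

text \<open>
  On elements of length \<open>m\<close> this is the Koszul sign of moving past an element of length \<open>n\<close>;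
  having it as a linear map makes the graded commutator bilinear without homogeneity assumptions.
\<close>

definition twist :: "nat \<Rightarrow> ('v list \<Rightarrow>\<^sub>0 'k::field) \<Rightarrow> ('v list \<Rightarrow>\<^sub>0 'k)" where
  "twist n = linear_ext (\<lambda>xs. Poly_Mapping.single xs ((- 1) ^ (n * length xs)))"

lemma lin_twist: "lin (twist n)"
  by (simp add: twist_def)

lemmas twist_simps [simp] =
  lin_add[OF lin_twist] lin_diff[OF lin_twist] lin_fscale[OF lin_twist]
  lin_zero[OF lin_twist]

lemma twist_homogeneous:
  assumes "p \<in> supported (\<lambda>xs. length xs = m)"
  shows "twist n p = fscale ((- 1) ^ (n * m)) p"
proof (rule lin_eqI[OF lin_twist])
  show "lin (fscale ((- 1) ^ (n * m)))"
    by (rule linI) (simp_all add: fs.scale_right_distrib mult.commute)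
qed (use supportedD[OF assms] in \<open>simp add: twist_def\<close>)

lemma twist_tensor_rel: "p \<in> tensor_rel scale \<Longrightarrow> twist n p \<in> tensor_rel scale"
proof (rule tensor_rel_image[OF lin_twist subspace_tensor_rel])
  fix xs ys
  have "linear_mod scale (tensor_rel scale)
      (\<lambda>a. fscale ((- 1) ^ (n * (Suc (length xs + length ys)))) (Poly_Mapping.single (xs @ [a] @ ys) 1))"
    by (rule linear_mod_compose[OF linear_mod_tensor_rel])
      (auto intro!: linI fs.subspace_scale subspace_tensor_rel simp: fs.scale_right_distrib mult.commute)
  then show "linear_mod scale (tensor_rel scale) (\<lambda>a. twist n (Poly_Mapping.single (xs @ [a] @ ys) 1))"
    by (simp add: twist_def)
qed

lemma tensor_prod_homogeneous:
  assumes "p \<in> supported (\<lambda>xs. length xs = m)" "q \<in> supported (\<lambda>xs. length xs = n)"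
  shows "p \<odot> q \<in> supported (\<lambda>xs. length xs = m + n)"
  by (rule bilinear_ext_supported[OF assms]) simp

lemma commutator_word_supported:
  "commutator_word w \<in> supported (\<lambda>xs. length xs = bracket_length w)"
proof (induction w)
  case (Br a b)
  show ?case
    using tensor_prod_homogeneous[OF Br.IH(1,2)] tensor_prod_homogeneous[OF Br.IH(2,1)]
    by (simp add: fs.subspace_diff fs.subspace_scale subspace_supported add.commute)
qed (simp add: single_in_supported)

lemma linear_ext_commutator_word_left:
  "linear_ext commutator_word (bilinear_ext Br (Poly_Mapping.single w 1) r) =
     commutator_word w \<odot> linear_ext commutator_word r
     - twist (bracket_length w) (linear_ext commutator_word r) \<odot> commutator_word w"
  by (rule lin_eqI[where p = r])
    ((rule linI; simp add: fs.scale_right_diff_distrib)+,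
      simp add: twist_homogeneous[OF commutator_word_supported])

lemma linear_ext_commutator_word_right:
  "linear_ext commutator_word (bilinear_ext Br r (Poly_Mapping.single w 1)) =
     linear_ext commutator_word r \<odot> commutator_word w
     - commutator_word w \<odot> twist (bracket_length w) (linear_ext commutator_word r)"
  by (rule lin_eqI[where p = r])
    ((rule linI; simp add: fs.scale_right_diff_distrib)+,
      simp add: twist_homogeneous[OF commutator_word_supported] mult.commute)

lemma graded_commutator_antisym:
  fixes p q :: "'v list \<Rightarrow>\<^sub>0 'k::field"
  assumes "s = 1 \<or> s = - 1"
  shows "(p \<odot> q - fscale s (q \<odot> p)) + fscale s (q \<odot> p - fscale s (p \<odot> q)) = 0"
  using assms by auto

text \<open>The Koszul signs of the three pairs are kept as arbitrary units, 1 or -1; products such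
  as \<open>s * t\<close> arise because the sign of passing a bracket is the product of the signs of
  passing its entries. The eight cases then need only associativity.\<close>

lemma graded_commutator_jacobi:
  fixes p q r :: "'v list \<Rightarrow>\<^sub>0 'k::field"
  assumes "s = 1 \<or> s = - 1" "t = 1 \<or> t = - 1" "u = 1 \<or> u = - 1"
  defines "c \<equiv> \<lambda>s p q. p \<odot> q - fscale s (q \<odot> p)"
  shows "c (s * t) p (c u q r) - c (t * u) (c s p q) r - fscale s (c (s * u) q (c t p r)) = 0"
  using assms(1-3) unfolding c_def by (auto simp: tensor_prod_assoc)

lemma minus_one_power_cases: "(- 1) ^ n = (1 :: 'k::field) \<or> (- 1) ^ n = (- 1 :: 'k)"
  by (cases "even n") auto

text \<open>Antisymmetry and Jacobi relators go to zero already among words; only linearity in the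
  generators uses tensor relations. Ideal closure is preserved because bracketing with a fixed word
  becomes a difference of products, and the tensor relations are a two-sided ideal stable under
  \<open>twist\<close>.\<close>

lemma commutator_word_lie_relators:
  fixes r :: "'v::ab_group_add bracket_word \<Rightarrow>\<^sub>0 'k::field"
  shows "r \<in> lie_relators scale \<Longrightarrow> linear_ext commutator_word r \<in> tensor_rel scale"
proof (induction rule: lie_relators.induct)
  case (gen_add x y)
  then show ?case using linear_mod_tensor_rel[of scale "[]" "[]"] by (simp add: linear_mod_def)
next
  case (gen_scale c x)
  then show ?case using linear_mod_tensor_rel[of scale "[]" "[]"] by (simp add: linear_mod_def)
next
  case (antisym a b)
  have "linear_ext commutator_word
      (Poly_Mapping.single (Br a b) 1 + Poly_Mapping.single (Br b a) (koszul a b)) = (0 :: _ \<Rightarrow>\<^sub>0 'k)"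
    using graded_commutator_antisym[OF minus_one_power_cases[of "bracket_length a * bracket_length b"],
        of "commutator_word a" "commutator_word b"]
    by (simp add: mult.commute)
  then show ?case by (simp only: fs.subspace_0[OF subspace_tensor_rel])
next
  case (jacobi a b c)
  have "linear_ext commutator_word
      (Poly_Mapping.single (Br a (Br b c)) 1 - Poly_Mapping.single (Br (Br a b) c) 1
        - Poly_Mapping.single (Br b (Br a c)) (koszul a b)) = (0 :: _ \<Rightarrow>\<^sub>0 'k)"
    using graded_commutator_jacobi[OF minus_one_power_cases[of "bracket_length a * bracket_length b"]
        minus_one_power_cases[of "bracket_length a * bracket_length c"]
        minus_one_power_cases[of "bracket_length b * bracket_length c"],
        of "commutator_word a" "commutator_word b" "commutator_word c"]
    by (simp add: distrib_left distrib_right power_add mult.commute)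
  then show ?case by (simp only: fs.subspace_0[OF subspace_tensor_rel])
next
  case (ideal_left r w)
  then show ?case
    by (simp add: linear_ext_commutator_word_left fs.subspace_diff[OF subspace_tensor_rel]
        tensor_rel_prod_left tensor_rel_prod_right twist_tensor_rel)
next
  case (ideal_right r w)
  then show ?case
    by (simp add: linear_ext_commutator_word_right fs.subspace_diff[OF subspace_tensor_rel]
        tensor_rel_prod_left tensor_rel_prod_right twist_tensor_rel)
qed

lemma commutator_word_lie_rel:
  "p \<in> lie_rel scale \<Longrightarrow> linear_ext commutator_word p \<in> tensor_rel scale"
  unfolding lie_rel_def
  by (rule lin_mem_span[OF lin_linear_ext subspace_tensor_rel commutator_word_lie_relators])

section \<open>The Dynkin map\<close>

lemma subspace_lie_rel: "fs.subspace (lie_rel scale)"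
  by (simp add: lie_rel_def)

lemma lie_rel_Br_left:
  assumes "p \<in> lie_rel scale"
  shows "bilinear_ext Br q p \<in> lie_rel scale"
proof (subst lin_eq_linear_ext[OF lin_bilinear_ext_left], rule linear_ext_in_subspace[OF subspace_lie_rel])
  fix w
  show "bilinear_ext Br (Poly_Mapping.single w 1) p \<in> lie_rel scale"
    using lin_bilinear_ext_right subspace_lie_rel _ assms[unfolded lie_rel_def]
    by (rule lin_mem_span) (auto simp: lie_rel_def intro: fs.span_base ideal_left)
qed

lemma lie_rel_Br_right:
  assumes "p \<in> lie_rel scale"
  shows "bilinear_ext Br p q \<in> lie_rel scale"
proof (subst lin_eq_linear_ext[OF lin_bilinear_ext_right], rule linear_ext_in_subspace[OF subspace_lie_rel])
  fix w
  show "bilinear_ext Br p (Poly_Mapping.single w 1) \<in> lie_rel scale"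
    using lin_bilinear_ext_left subspace_lie_rel _ assms[unfolded lie_rel_def]
    by (rule lin_mem_span) (auto simp: lie_rel_def intro: fs.span_base ideal_right)
qed

section \<open>Adjoint action of tensors on brackets\<close>

definition ad_word :: "'v list \<Rightarrow> ('v bracket_word \<Rightarrow>\<^sub>0 'k::field) \<Rightarrow> ('v bracket_word \<Rightarrow>\<^sub>0 'k)" where
  "ad_word xs p = foldr (\<lambda>x. bilinear_ext Br (Poly_Mapping.single (Gen x) 1)) xs p"

text \<open>Left bracketing by letters, extended to tensors: it makes the free Lie algebra a left
  module over the tensor algebra, given here on representatives.\<close>

definition ad :: "('v list \<Rightarrow>\<^sub>0 'k::field) \<Rightarrow> ('v bracket_word \<Rightarrow>\<^sub>0 'k) \<Rightarrow> ('v bracket_word \<Rightarrow>\<^sub>0 'k)" where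
  "ad u p = linear_ext (\<lambda>xs. ad_word xs p) u"

lemma lin_ad_word: "lin (ad_word xs)"
  by (induction xs) (auto intro!: linI simp: ad_word_def lin_add lin_fscale)

lemmas ad_word_simps [simp] =
  lin_add[OF lin_ad_word] lin_diff[OF lin_ad_word] lin_fscale[OF lin_ad_word]
  lin_zero[OF lin_ad_word]

lemma ad_word_lie_rel: "p \<in> lie_rel scale \<Longrightarrow> ad_word xs p \<in> lie_rel scale"
  by (induction xs) (auto simp: ad_word_def lie_rel_Br_left)

lemma lin_ad: "lin (ad u)"
  unfolding ad_def by (rule lin_linear_ext_param) (rule lin_ad_word)

lemma lin_ad_left: "lin (\<lambda>u. ad u p)"
  unfolding ad_def by (rule lin_linear_ext)

lemmas ad_simps [simp] =
  lin_add[OF lin_ad] lin_diff[OF lin_ad] lin_fscale[OF lin_ad] lin_zero[OF lin_ad]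
  lin_add[OF lin_ad_left] lin_diff[OF lin_ad_left] lin_fscale[OF lin_ad_left]
  lin_zero[OF lin_ad_left]

lemma ad_lie_rel: "p \<in> lie_rel scale \<Longrightarrow> ad u p \<in> lie_rel scale"
  unfolding ad_def by (rule linear_ext_in_subspace[OF subspace_lie_rel ad_word_lie_rel])

lemma ad_single [simp]: "ad (Poly_Mapping.single xs c) p = fscale c (ad_word xs p)"
  by (simp add: ad_def)

lemma ad_prod: "ad (u \<odot> v) p = ad u (ad v p)"
proof (rule lin_eqI[where p = u])
  fix xs
  show "ad (Poly_Mapping.single xs 1 \<odot> v) p = ad (Poly_Mapping.single xs 1) (ad v p)"
  proof (rule lin_eqI[where p = v])
    show "ad (Poly_Mapping.single xs 1 \<odot> Poly_Mapping.single ys 1) p =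
      ad (Poly_Mapping.single xs 1) (ad (Poly_Mapping.single ys 1) p)" for ys
      by (simp add: ad_word_def)
  qed (rule linI; simp)+
qed (rule linI; simp)+

text \<open>The Jacobi relator is rearranged as an identity of operators on \<open>p\<close>, the
  form that matches the graded commutator in \<open>commutator_word (Br a b)\<close>.\<close>

lemma Br_jacobi:
  "bilinear_ext Br (Poly_Mapping.single a 1) (bilinear_ext Br (Poly_Mapping.single b 1) p)
    - fscale (koszul a b) (bilinear_ext Br (Poly_Mapping.single b 1) (bilinear_ext Br (Poly_Mapping.single a 1) p))
    - bilinear_ext Br (Poly_Mapping.single (Br a b) 1) p \<in> lie_rel scale"
proof (rule lin_diffI[OF _ lin_bilinear_ext_right subspace_lie_rel, where p = p])
  fix c
  have "Poly_Mapping.single (Br a (Br b c)) 1 - Poly_Mapping.single (Br (Br a b) c) 1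
      - Poly_Mapping.single (Br b (Br a c)) (koszul a b) \<in> lie_rel scale"
    unfolding lie_rel_def by (rule fs.span_base) (rule jacobi)
  then show "bilinear_ext Br (Poly_Mapping.single a 1) (bilinear_ext Br (Poly_Mapping.single b 1) (Poly_Mapping.single c 1))
    - fscale (koszul a b) (bilinear_ext Br (Poly_Mapping.single b 1)
        (bilinear_ext Br (Poly_Mapping.single a 1) (Poly_Mapping.single c 1)))
    - bilinear_ext Br (Poly_Mapping.single (Br a b) 1) (Poly_Mapping.single c 1) \<in> lie_rel scale"
    by (simp add: algebra_simps)
qed (rule linI; simp add: fs.scale_right_distrib fs.scale_right_diff_distrib mult.commute)

text \<open>Letters agree by definition. On a bracket, \<open>ad_prod\<close> turns the first term
  into a graded commutator of operators, and \<open>Br_jacobi\<close> does the same for the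
  second.\<close>

lemma ad_commutator_word:
  fixes p :: "'v::ab_group_add bracket_word \<Rightarrow>\<^sub>0 'k::field"
  shows "ad (commutator_word w) p - bilinear_ext Br (Poly_Mapping.single w 1) p \<in> lie_rel scale"
proof (induction w arbitrary: p)
  case (Gen x)
  show ?case by (simp add: ad_word_def fs.subspace_0[OF subspace_lie_rel])
next
  case (Br a b)
  let ?L = "\<lambda>w. bilinear_ext Br (Poly_Mapping.single w (1::'k))"
  \<comment> \<open>A composite is changed one factor at a time: first the outer operator, then the
    inner one under the outer left bracketing, which respects the Lie relations.\<close>
  have comp: "ad (commutator_word v) (ad (commutator_word w) p) - ?L v (?L w p) \<in> lie_rel scale"
    if v: "\<And>p. ad (commutator_word v) p - ?L v p \<in> lie_rel scale"
      and w: "\<And>p. ad (commutator_word w) p - ?L w p \<in> lie_rel scale" for v w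
    using fs.subspace_add[OF subspace_lie_rel v[of "ad (commutator_word w) p"]
        lie_rel_Br_left[OF w[of p], of "Poly_Mapping.single v 1"]]
    by simp
  let ?s = "koszul a b :: 'k"
  have "(ad (commutator_word a) (ad (commutator_word b) p) - ?L a (?L b p))
      - fscale ?s (ad (commutator_word b) (ad (commutator_word a) p) - ?L b (?L a p))
      + (?L a (?L b p) - fscale ?s (?L b (?L a p)) - ?L (Br a b) p) \<in> lie_rel scale"
    by (intro fs.subspace_add fs.subspace_diff fs.subspace_scale subspace_lie_rel comp Br.IH Br_jacobi)
  then show ?case
    by (simp add: ad_prod
        fs.scale_right_diff_distrib algebra_simps)
qed

text \<open>The empty word is sent to 0 explicitly because \<open>right_normed\<close> has no
  equation for it.\<close>

definition dynkin :: "('v list \<Rightarrow>\<^sub>0 'k::field) \<Rightarrow> ('v bracket_word \<Rightarrow>\<^sub>0 'k)" where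
  "dynkin = linear_ext (\<lambda>xs. if xs = [] then 0 else Poly_Mapping.single (right_normed xs) 1)"

lemma lin_dynkin: "lin dynkin"
  by (simp add: dynkin_def)

lemmas dynkin_simps [simp] =
  lin_add[OF lin_dynkin] lin_diff[OF lin_dynkin] lin_fscale[OF lin_dynkin]
  lin_zero[OF lin_dynkin]

lemma right_normed_Cons: "xs \<noteq> [] \<Longrightarrow> right_normed (x # xs) = Br (Gen x) (right_normed xs)"
  by (cases xs) auto

lemma single_right_normed_append:
  "ys \<noteq> [] \<Longrightarrow> Poly_Mapping.single (right_normed (xs @ ys)) (1 :: 'k::field) =
     ad_word xs (Poly_Mapping.single (right_normed ys) 1)"
proof (induction xs)
  case (Cons x xs)
  have "Poly_Mapping.single (right_normed ((x # xs) @ ys)) (1 :: 'k) =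
      bilinear_ext Br (Poly_Mapping.single (Gen x) 1) (Poly_Mapping.single (right_normed (xs @ ys)) 1)"
    using Cons.prems by (simp add: right_normed_Cons)
  then show ?case
    using Cons.IH[OF Cons.prems] by (simp only: ad_word_def foldr_Cons o_apply)
qed (simp add: ad_word_def)

text \<open>A right-normed bracket is its final part acted on by the earlier letters. The empty word
  must be absent from \<open>v\<close>: \<open>dynkin\<close> sends it to 0, but need not do so for
  \<open>xs @ []\<close>.\<close>

lemma dynkin_prod:
  assumes "v \<in> supported (\<lambda>xs. xs \<noteq> [])"
  shows "dynkin (u \<odot> v) = ad u (dynkin v)"
proof (rule lin_eqI[where p = u])
  fix xs
  show "dynkin (Poly_Mapping.single xs 1 \<odot> v) = ad (Poly_Mapping.single xs 1) (dynkin v)"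
  proof (rule lin_eqI[where p = v])
    show "dynkin (Poly_Mapping.single xs 1 \<odot> Poly_Mapping.single ys 1) =
      ad (Poly_Mapping.single xs 1) (dynkin (Poly_Mapping.single ys 1))"
      if "ys \<in> Poly_Mapping.keys v" for ys
      using supportedD[OF assms that] by (simp add: dynkin_def single_right_normed_append)
  qed (rule linI; simp)+
qed (rule linI; simp)+

lemma bracket_length_pos: "bracket_length w > 0"
  by (induction w) auto

lemma commutator_word_nonempty: "commutator_word w \<in> supported (\<lambda>xs. xs \<noteq> [])"
  using commutator_word_supported[of w] bracket_length_pos[of w] by (fastforce simp: supported_def)

text \<open>
  Dynkin-Specht-Wever: the Dynkin map sends a product to the adjoint action of the first factor on
  the image of the second, so each half of the commutator contributes the length of one factor.
\<close>

lemma dynkin_commutator_word: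
  fixes scale :: "'k::field \<Rightarrow> 'v::ab_group_add \<Rightarrow> 'v"
  shows "dynkin (commutator_word w) - Poly_Mapping.single w (of_nat (bracket_length w)) \<in> lie_rel scale"
proof (induction w)
  case (Gen x)
  show ?case by (simp add: dynkin_def fs.subspace_0[OF subspace_lie_rel])
next
  case (Br a b)
  let ?n = "\<lambda>w. of_nat (bracket_length w) :: 'k"
  have step: "ad (commutator_word v) (dynkin (commutator_word w)) - Poly_Mapping.single (Br v w) (?n w)
      \<in> lie_rel scale"
    if "dynkin (commutator_word w) - Poly_Mapping.single w (?n w) \<in> lie_rel scale" for v w
    using fs.subspace_add[OF subspace_lie_rel
        ad_lie_rel[OF that, of "commutator_word v"]
        ad_commutator_word[of v "Poly_Mapping.single w (?n w)"]]
    by simp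
  let ?s = "koszul a b :: 'k"
  have anti: "Poly_Mapping.single (Br a b) 1 + Poly_Mapping.single (Br b a) ?s \<in> lie_rel scale"
    unfolding lie_rel_def by (rule fs.span_base) (rule antisym)
  \<comment> \<open>The first summand supplies the length of \<open>b\<close>; the second supplies
    the length of \<open>a\<close> on the reversed bracket, which antisymmetry turns back.\<close>
  have "(ad (commutator_word a) (dynkin (commutator_word b)) - Poly_Mapping.single (Br a b) (?n b))
      - fscale ?s (ad (commutator_word b) (dynkin (commutator_word a)) - Poly_Mapping.single (Br b a) (?n a))
      - fscale (?n a) (Poly_Mapping.single (Br a b) 1 + Poly_Mapping.single (Br b a) ?s) \<in> lie_rel scale"
    by (intro fs.subspace_diff fs.subspace_scale subspace_lie_rel step Br.IH anti)
  then show ?case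
    by (simp add: dynkin_prod commutator_word_nonempty
        fs.scale_right_diff_distrib fs.scale_right_distrib algebra_simps single_add)
qed

text \<open>The junk value \<open>1 / 0 = 0\<close> kills the empty word.\<close>

definition normalized_dynkin :: "('v list \<Rightarrow>\<^sub>0 'k::field) \<Rightarrow> ('v bracket_word \<Rightarrow>\<^sub>0 'k)" where
  "normalized_dynkin =
     linear_ext (\<lambda>xs. Poly_Mapping.single (right_normed xs) (1 / of_nat (length xs)))"

lemma lin_normalized_dynkin: "lin normalized_dynkin"
  by (simp add: normalized_dynkin_def)

lemmas normalized_dynkin_simps [simp] =
  lin_add[OF lin_normalized_dynkin] lin_diff[OF lin_normalized_dynkin]
  lin_fscale[OF lin_normalized_dynkin] lin_zero[OF lin_normalized_dynkin]

lemma normalized_dynkin_homogeneous: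
  assumes "p \<in> supported (\<lambda>xs. length xs = n)"
  shows "normalized_dynkin p = fscale (1 / of_nat n) (dynkin p)"
proof (rule lin_eqI[OF lin_normalized_dynkin])
  show "lin (\<lambda>p. fscale (1 / of_nat n) (dynkin p))"
    by (rule linI) (simp_all add: fs.scale_right_distrib)
  show "normalized_dynkin (Poly_Mapping.single xs 1) = fscale (1 / of_nat n) (dynkin (Poly_Mapping.single xs 1))"
    if "xs \<in> Poly_Mapping.keys p" for xs
    using supportedD[OF assms that] by (cases "xs = []") (auto simp: normalized_dynkin_def dynkin_def)
qed

text \<open>Dividing the Dynkin-Specht-Wever identity by the length is legitimate in characteristic
  0, every length being positive. The same congruence later serves for injectivity and for spanning
  by right-normed brackets.\<close>

lemma normalized_dynkin_commutator:
  fixes p :: "'v::ab_group_add bracket_word \<Rightarrow>\<^sub>0 'k::field_char_0"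
  shows "normalized_dynkin (linear_ext commutator_word p) - p \<in> lie_rel scale"
proof (rule lin_diffI[OF _ _ subspace_lie_rel, where p = p])
  fix w :: "'v bracket_word"
  let ?n = "of_nat (bracket_length w) :: 'k"
  have "fscale (1 / ?n) (dynkin (commutator_word w) - Poly_Mapping.single w ?n) \<in> lie_rel scale"
    by (rule fs.subspace_scale[OF subspace_lie_rel dynkin_commutator_word])
  then show "normalized_dynkin (linear_ext commutator_word (Poly_Mapping.single w 1))
      - Poly_Mapping.single w (1 :: 'k) \<in> lie_rel scale"
    using bracket_length_pos[of w]
    by (simp add: normalized_dynkin_homogeneous[OF commutator_word_supported] fs.scale_right_diff_distrib)
qed (rule linI; simp)+

lemma linear_mod_right_normed:
  "linear_mod scale (lie_rel scale) (\<lambda>a. Poly_Mapping.single (right_normed (xs @ [a] @ ys)) 1)"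
proof -
  have gen: "linear_mod scale (lie_rel scale) (\<lambda>a. Poly_Mapping.single (Gen a) 1)"
    using gen_add[where scale = scale] gen_scale[where scale = scale]
    by (auto simp: linear_mod_def lie_rel_def intro!: fs.span_base)
  have "linear_mod scale (lie_rel scale) (\<lambda>a. Poly_Mapping.single (right_normed ([a] @ ys)) 1)"
  proof (cases "ys = []")
    case False
    then show ?thesis
      using linear_mod_compose[OF gen
          lin_bilinear_ext_left[of Br "Poly_Mapping.single (right_normed ys) 1"] lie_rel_Br_right]
      by (simp add: right_normed_Cons)
  qed (simp add: gen)
  then have "linear_mod scale (lie_rel scale)
      (\<lambda>a. ad_word xs (Poly_Mapping.single (right_normed ([a] @ ys)) 1))"
    by (rule linear_mod_compose[OF _ lin_ad_word ad_word_lie_rel])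
  then show ?thesis by (simp add: single_right_normed_append)
qed

lemma normalized_dynkin_tensor_rel:
  "p \<in> tensor_rel scale \<Longrightarrow> normalized_dynkin p \<in> lie_rel scale"
proof (rule tensor_rel_image[OF lin_normalized_dynkin subspace_lie_rel])
  fix xs ys
  \<comment> \<open>The length of the word does not depend on the letter \<open>a\<close>, so the
    normalizing factor is constant in this slot.\<close>
  have "linear_mod scale (lie_rel scale) (\<lambda>a. fscale (1 / of_nat (Suc (length xs + length ys)))
      (Poly_Mapping.single (right_normed (xs @ [a] @ ys)) 1))"
    by (rule linear_mod_compose[OF linear_mod_right_normed])
      (auto intro!: linI fs.subspace_scale subspace_lie_rel simp: fs.scale_right_distrib)
  then show "linear_mod scale (lie_rel scale)
      (\<lambda>a. normalized_dynkin (Poly_Mapping.single (xs @ [a] @ ys) 1))"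
    by (simp add: normalized_dynkin_def)
qed

lemma commutator_injective:
  fixes p :: "'v::ab_group_add bracket_word \<Rightarrow>\<^sub>0 'k::field_char_0"
  assumes "linear_ext commutator_word p \<in> tensor_rel scale"
  shows "p \<in> lie_rel scale"
  using fs.subspace_diff[OF subspace_lie_rel normalized_dynkin_tensor_rel[OF assms]
      normalized_dynkin_commutator[of p scale]] by simp

section \<open>The Loday boundary\<close>

definition prefix_ext :: "'v \<Rightarrow> ('v list \<Rightarrow>\<^sub>0 'k::field) \<Rightarrow> ('v list \<Rightarrow>\<^sub>0 'k)" where
  "prefix_ext x p = Poly_Mapping.single [x] 1 \<odot> p"

lemma lin_prefix_ext: "lin (prefix_ext x)"
  unfolding prefix_ext_def by (rule lin_bilinear_ext_right)

lemmas prefix_ext_simps [simp] =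
  lin_add[OF lin_prefix_ext] lin_diff[OF lin_prefix_ext] lin_fscale[OF lin_prefix_ext]
  lin_zero[OF lin_prefix_ext]

lemma prefix_ext_single [simp]: "prefix_ext x (Poly_Mapping.single xs c) = Poly_Mapping.single (x # xs) c"
  by (simp add: prefix_ext_def)

lemma prefix_ext_prod: "prefix_ext x p \<odot> q = prefix_ext x (p \<odot> q)"
  by (simp add: prefix_ext_def tensor_prod_assoc)

text \<open>The derivation \<open>L\<^sub>x\<close> of the tensor algebra; it carries no signs
  because [x, -] preserves the degree of letters.\<close>

definition lie_action :: "('v \<Rightarrow> 'v \<Rightarrow> 'v) \<Rightarrow> 'v \<Rightarrow> 'v list \<Rightarrow> ('v list \<Rightarrow>\<^sub>0 'k::field)" where
  "lie_action br x ys = (\<Sum>j<length ys. Poly_Mapping.single (ys[j := br x (ys ! j)]) 1)"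

lemma lie_action_Nil [simp]: "lie_action br x [] = 0"
  by (simp add: lie_action_def)

lemma lie_action_Cons [simp]:
  "lie_action br x (y # ys) = Poly_Mapping.single (br x y # ys) 1 + prefix_ext y (lie_action br x ys)"
  by (simp add: lie_action_def sum.lessThan_Suc_shift lin_sum[OF lin_prefix_ext] del: sum.lessThan_Suc)

lemma tensor_prod_unit [simp]: "Poly_Mapping.single [] 1 \<odot> p = p"
  by (rule lin_eqI[where p = p]) (rule linI, simp_all)+

lemma lie_action_append:
  "lie_action br x (ys @ zs) = lie_action br x ys \<odot> Poly_Mapping.single zs 1
     + Poly_Mapping.single ys 1 \<odot> lie_action br x zs"
proof (induction ys)
  case Nil
  then show ?case by simp
next
  case (Cons y ys)
  have "prefix_ext y (Poly_Mapping.single ys 1 \<odot> p) = Poly_Mapping.single (y # ys) 1 \<odot> p"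
    for p
    by (simp flip: prefix_ext_prod)
  with Cons show ?case
    by (simp add: prefix_ext_prod algebra_simps)
qed

lemma contract_Cons_0: "contract br 0 (Suc j) (x # ys) = ys[j := br x (ys ! j)]"
  by (simp add: contract_def)

lemma contract_Cons_Suc: "contract br (Suc i) (Suc j) (x # ys) = x # contract br i j ys"
  by (simp add: contract_def Let_def)

lemma length_contract: "i < length xs \<Longrightarrow> length (contract br i j xs) = length xs - 1"
  by (simp add: contract_def Let_def)

text \<open>The index \<open>i = 0\<close> is split off; the remaining indices shift by one, which
  flips their sign. Leaving \<open>F\<close> open serves both \<open>loday_word\<close> and
  \<open>lie_boundary_word\<close>, whose double sums have the same shape.\<close>

lemma sum_contract_Cons:
  fixes F :: "'v list \<Rightarrow> 'k::field \<Rightarrow> 'a::ab_group_add"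
  shows "(\<Sum>j<length (x # ys). \<Sum>i<j. F (contract br i j (x # ys)) ((- 1) ^ i)) =
    (\<Sum>j<length ys. F (ys[j := br x (ys ! j)]) 1)
    + (\<Sum>j<length ys. \<Sum>i<j. F (x # contract br i j ys) (- ((- 1) ^ i)))"
  by (simp add: sum.lessThan_Suc_shift contract_Cons_0 contract_Cons_Suc sum.distrib del: sum.lessThan_Suc)

lemma loday_word_Nil [simp]: "loday_word br [] = 0"
  by (simp add: loday_word_def)

lemma loday_word_Cons [simp]:
  "loday_word br (x # ys) = lie_action br x ys - prefix_ext x (loday_word br ys)"
  unfolding loday_word_def sum_contract_Cons
  by (simp add: lie_action_def lin_sum[OF lin_prefix_ext] single_uminus sum_negf)

lemma loday_word_supported: "loday_word br xs \<in> supported (\<lambda>ys. Suc (length ys) = length xs)"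
  unfolding loday_word_def
  by (intro fs.subspace_sum subspace_supported single_in_supported) (auto simp: length_contract)

text \<open>
  The induction showing that this vanishes on commutators needs arbitrary \<open>h\<close>: moving a letter
  \<open>x\<close> past the contraction replaces \<open>h v\<close> by \<open>x \<otimes> h v\<close>.
\<close>

primrec contraction :: "('v \<Rightarrow> ('v list \<Rightarrow>\<^sub>0 'k::field)) \<Rightarrow> 'v list \<Rightarrow> ('v list \<Rightarrow>\<^sub>0 'k)" where
  "contraction h [] = 0"
| "contraction h (y # ys) = Poly_Mapping.single ys 1 \<odot> h y - prefix_ext y (contraction h ys)"

text \<open>\<open>contraction h\<close> removes one letter with alternating sign and appends its
  image under \<open>h\<close> at the end. A final letter \<open>x\<close> that stays stands just
  before that image, so it can be absorbed into \<open>h\<close>.\<close>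

lemma contraction_snoc:
  "contraction h (ys @ [x]) = contraction (\<lambda>v. prefix_ext x (h v)) ys
     + fscale ((- 1) ^ length ys) (Poly_Mapping.single ys 1 \<odot> h x)"
proof (induction ys)
  case (Cons y ys)
  have "Poly_Mapping.single (ys @ [x]) 1 \<odot> h y = Poly_Mapping.single ys 1 \<odot> prefix_ext x (h y)"
    by (simp add: prefix_ext_def flip: tensor_prod_assoc)
  moreover have "prefix_ext y (Poly_Mapping.single ys 1 \<odot> h x) = Poly_Mapping.single (y # ys) 1 \<odot> h x"
    by (simp flip: prefix_ext_prod)
  ultimately show ?case
    using Cons by simp
qed simp

text \<open>Terms whose second index lies in \<open>ys\<close> leave \<open>x\<close> alone; those
  that bracket into \<open>x\<close> take a letter out of \<open>ys\<close> and put its bracket with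
  \<open>x\<close> at the end, which is a contraction.\<close>

lemma loday_word_snoc:
  "loday_word br (ys @ [x]) = loday_word br ys \<odot> Poly_Mapping.single [x] 1
     + contraction (\<lambda>v. Poly_Mapping.single [br v x] 1) ys"
proof (induction ys)
  case (Cons y ys)
  then show ?case
    by (simp add: lie_action_append prefix_ext_simps prefix_ext_prod algebra_simps)
qed simp

section \<open>Contractions and boundary of right-normed brackets\<close>

lemma commutator_word_right_normed_supported:
  "xs \<noteq> [] \<Longrightarrow> commutator_word (right_normed xs) \<in> supported (\<lambda>ys. length ys = length xs)"
  using commutator_word_supported[of "right_normed xs"] by (simp add: bracket_length_right_normed)

lemma commutator_word_right_normed_Cons:
  assumes "xs \<noteq> []"
  shows "commutator_word (right_normed (x # xs)) =
    prefix_ext x (commutator_word (right_normed xs))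
    - fscale ((- 1) ^ length xs) (commutator_word (right_normed xs) \<odot> Poly_Mapping.single [x] 1)"
  using commutator_word_right_normed[OF assms] by (simp add: prefix_ext_def)

lemma contraction_prefix_ext:
  "linear_ext (contraction h) (prefix_ext x p) = p \<odot> h x - prefix_ext x (linear_ext (contraction h) p)"
  by (rule lin_eqI[where p = p])
    ((rule linI; simp add: fs.scale_right_diff_distrib algebra_simps)+, simp)

lemma contraction_prod_single:
  assumes "p \<in> supported (\<lambda>xs. length xs = n)"
  shows "linear_ext (contraction h) (p \<odot> Poly_Mapping.single [x] 1) =
    linear_ext (contraction (\<lambda>v. prefix_ext x (h v))) p + fscale ((- 1) ^ n) (p \<odot> h x)"
proof (rule lin_eqI[where p = p])
  fix ys assume "ys \<in> Poly_Mapping.keys p"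
  then show "linear_ext (contraction h) (Poly_Mapping.single ys 1 \<odot> Poly_Mapping.single [x] 1) =
    linear_ext (contraction (\<lambda>v. prefix_ext x (h v))) (Poly_Mapping.single ys 1)
      + fscale ((- 1) ^ n) (Poly_Mapping.single ys 1 \<odot> h x)"
    using supportedD[OF assms] by (simp add: contraction_snoc)
qed (rule linI; simp add: fs.scale_right_distrib mult.commute)+

text \<open>For a bracket of \<open>x\<close> with a longer bracket b, the induction hypothesis
  kills the terms that remove a letter of b, for \<open>h\<close> and for its modification by
  \<open>x\<close>. What is left is b followed by \<open>h x\<close>, once from each half of the
  commutator, with opposite signs.\<close>

lemma contraction_commutator_word:
  fixes h :: "'v \<Rightarrow> ('v list \<Rightarrow>\<^sub>0 'k::field)"
  assumes "xs \<noteq> []"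
  shows "linear_ext (contraction h) (commutator_word (right_normed (x # xs))) = 0"
  using assms
proof (induction xs arbitrary: x h rule: right_normed.induct)
  \<comment> \<open>A single letter contracts to \<open>h y\<close>, not to 0, so brackets of two
    letters are computed directly.\<close>
  case (1 y)
  then show ?case by (simp add: prefix_ext_def)
next
  case (2 y z zs)
  let ?b = "commutator_word (right_normed (y # z # zs)) :: 'v list \<Rightarrow>\<^sub>0 'k" and ?n = "length (y # z # zs)"
  have b: "?b \<in> supported (\<lambda>ys. length ys = ?n)"
    by (rule commutator_word_right_normed_supported) simp
  have IH: "linear_ext (contraction h) ?b = 0" for h
    by (rule "2.IH") simp
  have "linear_ext (contraction h) (commutator_word (right_normed (x # y # z # zs))) =
     ?b \<odot> h x - fscale ((- 1) ^ ?n) (fscale ((- 1) ^ ?n) (?b \<odot> h x))"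
    by (simp only: commutator_word_right_normed_Cons[of "y # z # zs"] list.distinct not_False_eq_True
        linear_ext_simps contraction_prefix_ext contraction_prod_single[OF b] IH prefix_ext_simps) simp
  also have "\<dots> = 0"
    by (simp add: flip: power_mult_distrib)
  finally show ?case .
qed simp

lemma loday_prefix_ext:
  "linear_ext (loday_word br) (prefix_ext x p) =
     linear_ext (lie_action br x) p - prefix_ext x (linear_ext (loday_word br) p)"
  by (rule lin_eqI[where p = p])
    ((rule linI; simp add: fs.scale_right_diff_distrib algebra_simps)+, simp)

lemma loday_prod_single:
  "linear_ext (loday_word br) (p \<odot> Poly_Mapping.single [x] 1) =
     linear_ext (loday_word br) p \<odot> Poly_Mapping.single [x] 1
     + linear_ext (contraction (\<lambda>v. Poly_Mapping.single [br v x] 1)) p"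
  by (rule lin_eqI[where p = p])
    ((rule linI; simp add: fs.scale_right_distrib algebra_simps)+, simp add: loday_word_snoc)

lemma lie_action_prefix_ext:
  "linear_ext (lie_action br x) (prefix_ext y p) =
     prefix_ext (br x y) p + prefix_ext y (linear_ext (lie_action br x) p)"
  by (rule lin_eqI[where p = p])
    ((rule linI; simp add: fs.scale_right_distrib algebra_simps)+, simp)

lemma lie_action_prod_single:
  "linear_ext (lie_action br x) (p \<odot> Poly_Mapping.single [y] 1) =
     linear_ext (lie_action br x) p \<odot> Poly_Mapping.single [y] 1 + p \<odot> Poly_Mapping.single [br x y] 1"
  by (rule lin_eqI[where p = p])
    ((rule linI; simp add: fs.scale_right_distrib algebra_simps)+, simp add: lie_action_append)

text \<open>An unsigned derivation of the tensor product is also one of the graded commutator, so it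
  passes through the nested brackets to one entry at a time.\<close>

lemma lie_action_commutator_word:
  fixes br :: "'v \<Rightarrow> 'v \<Rightarrow> 'v"
  shows "xs \<noteq> [] \<Longrightarrow> linear_ext (lie_action br x) (commutator_word (right_normed xs)) =
     (\<Sum>j<length xs. commutator_word (right_normed (xs[j := br x (xs ! j)])) :: 'v list \<Rightarrow>\<^sub>0 'k::field)"
proof (induction xs)
  case (Cons y ys)
  show ?case
  proof (cases "ys = []")
    case False
    let ?b = "\<lambda>ys. commutator_word (right_normed ys) :: 'v list \<Rightarrow>\<^sub>0 'k" and ?s = "(- 1) ^ length ys"
    have "(\<Sum>j<length (y # ys). ?b ((y # ys)[j := br x ((y # ys) ! j)])) =
      ?b (br x y # ys) + (\<Sum>j<length ys. ?b (y # ys[j := br x (ys ! j)]))"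
      by (simp add: sum.lessThan_Suc_shift del: sum.lessThan_Suc)
    also have "(\<Sum>j<length ys. ?b (y # ys[j := br x (ys ! j)])) =
      (\<Sum>j<length ys. prefix_ext y (?b (ys[j := br x (ys ! j)]))
        - fscale ?s (?b (ys[j := br x (ys ! j)]) \<odot> Poly_Mapping.single [y] 1))"
      by (rule sum.cong) (use False in \<open>simp_all add: commutator_word_right_normed_Cons\<close>)
    also have "\<dots> = prefix_ext y (linear_ext (lie_action br x) (?b ys))
        - fscale ?s (linear_ext (lie_action br x) (?b ys) \<odot> Poly_Mapping.single [y] 1)"
      using Cons.IH[OF False]
      by (simp add: sum_subtractf lin_sum[OF lin_prefix_ext] lin_sum[OF lin_bilinear_ext_left]
          fs.scale_sum_right)
    finally show ?thesis
      using False
      by (simp add: commutator_word_right_normed_Cons lie_action_prefix_ext lie_action_prod_single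
          fs.scale_right_distrib algebra_simps)
  qed simp
qed simp

text \<open>With at least two letters in the tail, the exceptional last summand involves the tail
  alone, so it shares the sign change caused by splitting off \<open>x\<close>.\<close>

lemma lie_boundary_word_Cons:
  assumes "length ys \<ge> 2"
  shows "lie_boundary_word br (x # ys) =
    (\<Sum>j<length ys. Poly_Mapping.single (right_normed (ys[j := br x (ys ! j)])) 1)
    - bilinear_ext Br (Poly_Mapping.single (Gen x) 1) (lie_boundary_word br ys)"
proof -
  \<comment> \<open>This shape of the length lets the natural-number differences
    \<open>m - 1\<close> and \<open>m - 2\<close> compute.\<close>
  obtain k where k: "length ys = Suc (Suc k)"
    using assms by (metis add_2_eq_Suc le_Suc_ex)
  have c: "contract br i j ys \<noteq> []" if "j < length ys" "i < j" for i j
    using length_contract[of i ys br j] that assms by auto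
  have "(\<Sum>j<length ys. \<Sum>i<j. Poly_Mapping.single (right_normed (x # contract br i j ys)) (- ((- 1) ^ i))) =
    - bilinear_ext Br (Poly_Mapping.single (Gen x) 1)
      (\<Sum>j<length ys. \<Sum>i<j. Poly_Mapping.single (right_normed (contract br i j ys)) ((- 1) ^ i))"
    unfolding lin_sum[OF lin_bilinear_ext_right] sum_negf[symmetric]
    by (intro sum.cong refl) (simp add: right_normed_Cons c single_uminus)
  then show ?thesis
    unfolding lie_boundary_word_def Let_def
      sum_contract_Cons[where F = "\<lambda>zs. Poly_Mapping.single (right_normed zs)"]
    by (simp add: k right_normed_Cons single_uminus del: sum.lessThan_Suc)
qed

text \<open>The prefix and suffix rules expand the boundary of {x, b} into the action of
  \<open>x\<close> on b, two products of \<open>x\<close> with the boundary of b, and a contraction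
  of b. For longer b the contraction vanishes and the two products form minus a bracket with
  \<open>x\<close>, as in the recursion of \<open>lie_boundary_word\<close>.\<close>

lemma loday_commutator_word:
  fixes br :: "'v \<Rightarrow> 'v \<Rightarrow> 'v"
  shows "length xs \<ge> 2 \<Longrightarrow> linear_ext (loday_word br) (commutator_word (right_normed xs)) =
     (linear_ext commutator_word (lie_boundary_word br xs) :: 'v list \<Rightarrow>\<^sub>0 'k::field)"
proof (induction xs)
  case (Cons x ys)
  let ?b = "commutator_word (right_normed ys) :: 'v list \<Rightarrow>\<^sub>0 'k" and ?s = "(- 1) ^ length ys"
    and ?X = "Poly_Mapping.single [x] 1" and ?h = "\<lambda>v. Poly_Mapping.single [br v x] 1"
  have ys: "ys \<noteq> []" using Cons.prems by auto
  have eq: "linear_ext (loday_word br) (commutator_word (right_normed (x # ys))) =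
    linear_ext (lie_action br x) ?b - prefix_ext x (linear_ext (loday_word br) ?b)
    - fscale ?s (linear_ext (loday_word br) ?b \<odot> ?X) - fscale ?s (linear_ext (contraction ?h) ?b)"
    by (simp add: commutator_word_right_normed_Cons[OF ys] loday_prefix_ext loday_prod_single
        fs.scale_right_distrib algebra_simps)
  show ?case
  proof (cases "length ys \<ge> 2")
    case False
    then obtain y where y: "ys = [y]" using ys by (cases ys) (auto simp: Suc_le_eq)
    \<comment> \<open>The contraction of the single letter \<open>y\<close> is [y, x]: this is the
      source of the exceptional summand in \<open>lie_boundary_word\<close>.\<close>
    show ?thesis unfolding eq
      by (simp add: y prefix_ext_simps lie_boundary_word_def contract_def lessThan_Suc numeral_2_eq_2 single_uminus)
  next
    case True
    then obtain y zs where "ys = y # zs" "zs \<noteq> []" by (cases ys) (auto simp: Suc_le_eq)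
    then have ext: "linear_ext (contraction ?h) ?b = 0" by (metis contraction_commutator_word)
    have act: "linear_ext (lie_action br x) ?b =
      linear_ext commutator_word (\<Sum>j<length ys. Poly_Mapping.single (right_normed (ys[j := br x (ys ! j)])) 1)"
      by (simp add: lie_action_commutator_word[OF ys] lin_sum[OF lin_linear_ext])
    let ?d = "lie_boundary_word br ys :: 'v bracket_word \<Rightarrow>\<^sub>0 'k"
    have sup: "linear_ext commutator_word ?d \<in> supported (\<lambda>zs. Suc (length zs) = length ys)"
      unfolding Cons.IH[OF True, symmetric]
      by (rule linear_ext_supported[OF commutator_word_right_normed_supported[OF ys]])
        (use loday_word_supported[of br] in metis)
    \<comment> \<open>The boundary is one letter shorter than \<open>ys\<close>, so its Koszul sign
      past \<open>x\<close> is the opposite of \<open>?s\<close>.\<close>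
    have tw: "twist 1 (linear_ext commutator_word ?d) = fscale (- ?s) (linear_ext commutator_word ?d)"
      using True sup by (subst twist_homogeneous[of _ "length ys - 1"])
        (auto simp: supported_def power_diff Suc_diff_eq_diff_pred elim: ballE
          intro: power_minus_odd)
    show ?thesis
      unfolding eq ext act Cons.IH[OF True] lie_boundary_word_Cons[OF True]
      using tw by (simp add: linear_ext_commutator_word_left prefix_ext_def algebra_simps)
  qed
qed simp

section \<open>The Loday complex\<close>

lemma tensor_rel_prefix_ext: "p \<in> tensor_rel scale \<Longrightarrow> prefix_ext x p \<in> tensor_rel scale"
  unfolding prefix_ext_def by (rule tensor_rel_prod_left)

context leibniz_algebra
begin

abbreviation "T \<equiv> tensor_rel scale"

lemma linear_mod_prefix_ext: "linear_mod scale T (\<lambda>a. prefix_ext a p)"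
  unfolding prefix_ext_def
  using linear_mod_compose[OF linear_mod_tensor_rel[of scale "[]" "[]"] lin_bilinear_ext_left tensor_rel_prod_right]
  by simp

lemma linear_mod_lie_action_left: "linear_mod scale T (\<lambda>a. lie_action br a ys)"
proof (induction ys)
  case (Cons y ys)
  have "linear_mod scale T (\<lambda>a. Poly_Mapping.single (br a y # ys) 1)"
    using linear_mod_precompose[OF linear_mod_tensor_rel[of scale "[]" ys] linear_left[of y]] by simp
  then show ?case
    unfolding lie_action_Cons
    by (rule linear_mod_add[OF subspace_tensor_rel])
      (rule linear_mod_compose[OF Cons lin_prefix_ext tensor_rel_prefix_ext])
qed (simp add: linear_mod_zero subspace_tensor_rel)

lemma linear_mod_lie_action: "linear_mod scale T (\<lambda>a. lie_action br x (xs @ [a] @ ys))"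
proof (induction xs)
  case Nil
  have "linear_mod scale T (\<lambda>a. Poly_Mapping.single (br x a # ys) 1)"
    using linear_mod_precompose[OF linear_mod_tensor_rel[of scale "[]" ys] linear_right[of x]] by simp
  then show ?case
    using linear_mod_add[OF subspace_tensor_rel _ linear_mod_prefix_ext] by simp
next
  case (Cons z xs)
  then show ?case
    using linear_mod_add[OF subspace_tensor_rel linear_mod_tensor_rel[of scale "br x z # xs" ys]
        linear_mod_compose[OF Cons lin_prefix_ext tensor_rel_prefix_ext]] by simp
qed

text \<open>The leading letter both acts on the rest and is prefixed to it; any other letter sits
  inside both terms of the recursion. Linearity of the bracket in each argument thus covers every
  slot.\<close>

lemma linear_mod_loday_word: "linear_mod scale T (\<lambda>a. loday_word br (xs @ [a] @ ys))"
proof (induction xs)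
  case Nil
  then show ?case
    using linear_mod_diff[OF subspace_tensor_rel linear_mod_lie_action_left linear_mod_prefix_ext] by simp
next
  case (Cons z xs)
  then show ?case
    using linear_mod_diff[OF subspace_tensor_rel linear_mod_lie_action[of z xs ys]
        linear_mod_compose[OF Cons lin_prefix_ext tensor_rel_prefix_ext]] by simp
qed

lemma loday_tensor_rel: "p \<in> T \<Longrightarrow> linear_ext (loday_word br) p \<in> T"
  by (rule tensor_rel_image[OF lin_linear_ext subspace_tensor_rel])
    (use linear_mod_loday_word in simp)

text \<open>On a letter this is the Leibniz identity; mixed terms, where \<open>x\<close> and
  \<open>y\<close> act on different letters, cancel. Relations enter because the identity adds two
  vectors inside one slot.\<close>

lemma lie_action_br:
  "lie_action br (br x y) zs
    - (linear_ext (lie_action br x) (lie_action br y zs) - linear_ext (lie_action br y) (lie_action br x zs)) \<in> T"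
proof (induction zs)
  case (Cons z zs)
  have "Poly_Mapping.single (br x (br y z) # zs) 1 - Poly_Mapping.single (br (br x y) z # zs) 1
      - Poly_Mapping.single (br y (br x z) # zs) 1 \<in> T"
    using linear_mod_tensor_rel[of scale "[]" zs] unfolding leibniz[of x y z]
    by (auto simp: linear_mod_def)
  from fs.subspace_diff[OF subspace_tensor_rel tensor_rel_prefix_ext[OF Cons, of z] this]
  show ?case
    by (simp add: lie_action_prefix_ext prefix_ext_simps algebra_simps)
qed (simp add: fs.subspace_0 subspace_tensor_rel)

text \<open>Expanding both composites on \<open>y # ys\<close> leaves the defect of
  \<open>lie_action_br\<close> for \<open>x\<close> and \<open>y\<close>, minus the claim for
  \<open>ys\<close> prefixed by \<open>y\<close>.\<close>

lemma loday_lie_action: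
  "linear_ext (loday_word br) (lie_action br x ys) - linear_ext (lie_action br x) (loday_word br ys) \<in> T"
proof (induction ys)
  case (Cons y ys)
  from fs.subspace_diff[OF subspace_tensor_rel lie_action_br[of x y ys] tensor_rel_prefix_ext[OF Cons, of y]]
  show ?case
    by (simp add: loday_prefix_ext lie_action_prefix_ext prefix_ext_simps algebra_simps)
qed (simp add: fs.subspace_0 subspace_tensor_rel)

text \<open>With L the action of \<open>x\<close>, the square on x w is (\<partial>L - L\<partial>)w
  + x \<partial>\<partial>w, so commutation with the action suffices.\<close>

lemma loday_loday_word: "linear_ext (loday_word br) (loday_word br xs) \<in> T"
proof (induction xs)
  case (Cons x xs)
  from fs.subspace_add[OF subspace_tensor_rel loday_lie_action[of x xs] tensor_rel_prefix_ext[OF Cons, of x]]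
  show ?case
    by (simp add: loday_prefix_ext algebra_simps)
qed (simp add: fs.subspace_0 subspace_tensor_rel)

lemma loday_square: "linear_ext (loday_word br) (linear_ext (loday_word br) p) \<in> T"
proof -
  have l: "lin (\<lambda>p. linear_ext (loday_word br) (linear_ext (loday_word br) p) :: 'v list \<Rightarrow>\<^sub>0 'k)"
    by (rule lin_compose) simp_all
  show ?thesis
    by (subst lin_eq_linear_ext[OF l]) (rule linear_ext_in_subspace[OF subspace_tensor_rel], simp add: loday_loday_word)
qed

end

section \<open>The boundary of the free graded Lie algebra\<close>

lemma length_part_subspace:
  "fs.subspace U \<Longrightarrow> quot_subspace U (length_part U len P)"
  unfolding length_part_eq by (rule quot_subspace_image[OF _ subspace_supported])

lemma commutator_supported:
  "p \<in> supported (\<lambda>w. P (bracket_length w)) \<Longrightarrow>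
     linear_ext commutator_word p \<in> supported (\<lambda>xs. P (length xs))"
  by (rule linear_ext_supported, assumption)
    (use commutator_word_supported in \<open>fastforce simp: supported_def\<close>)

lemma loday_supported:
  assumes "p \<in> supported (\<lambda>xs. length xs = Suc n)"
  shows "linear_ext (loday_word br) p \<in> supported (\<lambda>xs. length xs = n)"
  using assms by (rule linear_ext_supported) (use loday_word_supported in \<open>fastforce simp: supported_def\<close>)

lemma loday_length_one:
  assumes "p \<in> supported (\<lambda>xs. length xs = 1)"
  shows "linear_ext (loday_word br) p = 0"
proof (rule lin_eqI[where g = "\<lambda>_. 0" and p = p])
  show "linear_ext (loday_word br) (Poly_Mapping.single xs 1) = 0" if "xs \<in> Poly_Mapping.keys p" for xs
    using supportedD[OF assms that] by (auto simp: length_Suc_conv)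
qed (auto intro: linI)

text \<open>One-letter words go to 0, so lowering the length never produces the empty word.\<close>

lemma loday_supported_pos:
  assumes "p \<in> supported (\<lambda>xs. length xs \<ge> 1)"
  shows "linear_ext (loday_word br) p \<in> supported (\<lambda>xs. length xs \<ge> 1)"
  using assms
proof (rule linear_ext_supported)
  fix xs :: "'a list" assume "length xs \<ge> 1"
  \<comment> \<open>\<open>remdups_adj.cases\<close> supplies the case split into empty, one-letter
    and longer lists.\<close>
  then consider x where "xs = [x]" | "length xs \<ge> 2" by (cases xs rule: remdups_adj.cases) auto
  then show "loday_word br xs \<in> supported (\<lambda>ys. length ys \<ge> 1)"
  proof cases
    case 1
    then show ?thesis by (simp add: fs.subspace_0 subspace_supported)
  next
    case 2
    then show ?thesis
      using loday_word_supported[of br xs] by (fastforce simp: supported_def)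
  qed
qed

text \<open>A word \<open>xs\<close> of length n stands for \<open>right_normed xs\<close> divided
  by n, so this is the prescribed boundary of its image under \<open>normalized_dynkin\<close>.
  Composed with \<epsilon> it gives a candidate for the boundary on all bracket words, linear by
  construction.\<close>

definition lie_boundary_ext :: "('v \<Rightarrow> 'v \<Rightarrow> 'v) \<Rightarrow> ('v list \<Rightarrow>\<^sub>0 'k::field) \<Rightarrow> ('v bracket_word \<Rightarrow>\<^sub>0 'k)" where
  "lie_boundary_ext br = linear_ext
     (\<lambda>xs. if length xs \<ge> 2 then fscale (1 / of_nat (length xs)) (lie_boundary_word br xs) else 0)"

lemma lin_lie_boundary_ext: "lin (lie_boundary_ext br)"
  by (simp add: lie_boundary_ext_def)

lemmas lie_boundary_ext_simps [simp] =
  lin_add[OF lin_lie_boundary_ext] lin_diff[OF lin_lie_boundary_ext]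
  lin_fscale[OF lin_lie_boundary_ext] lin_zero[OF lin_lie_boundary_ext]

text \<open>On words of length at least two this is \<open>loday_commutator_word\<close> divided by
  the length. A single letter has zero boundary, and the empty word gets the coefficient
  \<open>1 / 0 = 0\<close>.\<close>

lemma commutator_lie_boundary_ext:
  "linear_ext commutator_word (lie_boundary_ext br q) =
     linear_ext (loday_word br) (linear_ext commutator_word (normalized_dynkin q))"
proof (rule lin_eqI[where p = q])
  fix xs :: "'a list"
  consider "xs = []" | x where "xs = [x]" | "length xs \<ge> 2" by (cases xs rule: remdups_adj.cases) auto
  then show "linear_ext commutator_word (lie_boundary_ext br (Poly_Mapping.single xs 1)) =
     linear_ext (loday_word br) (linear_ext commutator_word (normalized_dynkin (Poly_Mapping.single xs 1)))"
    by cases (simp_all add: lie_boundary_ext_def normalized_dynkin_def loday_commutator_word)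
qed (rule linI; simp)+

lemma lie_boundary_word_supported:
  assumes "length xs = Suc (Suc n)"
  shows "lie_boundary_word br xs \<in> supported (\<lambda>w. bracket_length w = Suc n)"
proof -
  have c: "bracket_length (right_normed (contract br i j xs)) = Suc n" if "j < length xs" "i < j" for i j
    using length_contract[of i xs br j] that assms
    by (subst bracket_length_right_normed) auto
  have l: "bracket_length (right_normed (take n xs @ [x])) = Suc n" for x
    using assms by (subst bracket_length_right_normed) auto
  show ?thesis
    unfolding lie_boundary_word_def Let_def
    by (intro fs.subspace_add fs.subspace_sum subspace_supported single_in_supported c)
      (use l assms in auto)
qed

lemma lie_boundary_ext_supported:
  fixes q :: "'v list \<Rightarrow>\<^sub>0 'k::field"
  assumes "q \<in> supported (\<lambda>xs. length xs = Suc n)"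
  shows "lie_boundary_ext br q \<in> supported (\<lambda>w. bracket_length w = n)"
  unfolding lie_boundary_ext_def using assms
proof (rule linear_ext_supported)
  fix xs :: "'v list" assume xs: "length xs = Suc n"
  have "lie_boundary_word br xs \<in> (supported (\<lambda>w. bracket_length w = n) :: ('v bracket_word \<Rightarrow>\<^sub>0 'k) set)"
    if "n \<ge> 1"
    using lie_boundary_word_supported[of xs "n - 1" br] xs that by simp
  then show "(if length xs \<ge> 2 then fscale (1 / of_nat (length xs)) (lie_boundary_word br xs) else (0 :: _ \<Rightarrow>\<^sub>0 'k))
      \<in> supported (\<lambda>w. bracket_length w = n)"
    using xs by (auto simp: fs.subspace_0 fs.subspace_scale subspace_supported)
qed

lemma lie_boundary_ext_length_one:
  assumes "q \<in> supported (\<lambda>xs. length xs = 1)"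
  shows "lie_boundary_ext br q = 0"
proof (rule lin_eqI[OF lin_lie_boundary_ext, where g = "\<lambda>_. 0" and p = q])
  show "lie_boundary_ext br (Poly_Mapping.single xs 1) = 0" if "xs \<in> Poly_Mapping.keys q" for xs
    using supportedD[OF assms that] by (simp add: lie_boundary_ext_def)
qed (auto intro: linI)

locale leibniz_algebra_char_0 = leibniz_algebra scale br
  for scale :: "'k::field_char_0 \<Rightarrow> 'v::ab_group_add \<Rightarrow> 'v" and br
begin

abbreviation "R \<equiv> lie_rel scale"

abbreviation comm :: "('v bracket_word \<Rightarrow>\<^sub>0 'k) \<Rightarrow> ('v list \<Rightarrow>\<^sub>0 'k)" where
  "comm \<equiv> linear_ext commutator_word"

abbreviation loday :: "('v list \<Rightarrow>\<^sub>0 'k) \<Rightarrow> ('v list \<Rightarrow>\<^sub>0 'k)" where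
  "loday \<equiv> linear_ext (loday_word br)"

abbreviation dif :: "('v bracket_word \<Rightarrow>\<^sub>0 'k) \<Rightarrow> ('v bracket_word \<Rightarrow>\<^sub>0 'k)" where
  "dif p \<equiv> lie_boundary_ext br (comm p)"

lemma lin_dif: "lin dif"
  by (rule lin_compose[OF lin_lie_boundary_ext lin_linear_ext])

text \<open>The image of \<open>dif p\<close> under \<epsilon> is the boundary of that of
  \<open>normalized_dynkin (comm p)\<close>, which equals \<open>p\<close> up to Lie relations;
  \<epsilon> followed by the boundary carries these into tensor relations.\<close>

lemma comm_dif: "comm (dif p) - loday (comm p) \<in> T"
  using loday_tensor_rel[OF commutator_word_lie_rel[OF normalized_dynkin_commutator[of p scale]]]
  by (simp add: commutator_lie_boundary_ext)

lemma lie_rel_congI: "comm p - comm q \<in> T \<Longrightarrow> p - q \<in> R"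
  by (rule commutator_injective) simp

lemma dif_lie_rel:
  assumes "p \<in> R"
  shows "dif p \<in> R"
  using fs.subspace_add[OF subspace_tensor_rel comm_dif[of p] loday_tensor_rel[OF commutator_word_lie_rel[OF assms]]]
  by (intro commutator_injective) simp

text \<open>After \<epsilon>, each \<open>dif\<close> may be traded for \<open>loday\<close> modulo
  tensor relations, and the Loday boundary squares to zero there.\<close>

lemma dif_dif: "dif (dif p) \<in> R"
proof (rule commutator_injective)
  have "loday (comm (dif p) - loday (comm p)) \<in> T"
    by (rule loday_tensor_rel[OF comm_dif])
  from fs.subspace_add[OF subspace_tensor_rel comm_dif[of "dif p"]
      fs.subspace_add[OF subspace_tensor_rel this loday_square[of "comm p"]]]
  show "comm (dif (dif p)) \<in> T" by simp
qed

lemma dif_right_normed: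
  assumes "length xs \<ge> 2"
  shows "dif (Poly_Mapping.single (right_normed xs) 1) - lie_boundary_word br xs \<in> R"
  using comm_dif[of "Poly_Mapping.single (right_normed xs) 1"]
  by (intro lie_rel_congI) (simp add: loday_commutator_word[OF assms])

lemma lie_embedding_coset: "lie_embedding scale (coset R p) = coset T (comm p)"
  unfolding lie_embedding_def
  by (rule quot_map_coset[OF subspace_lie_rel subspace_tensor_rel lin_linear_ext commutator_word_lie_rel])

lemma loday_boundary_coset: "loday_boundary scale br (coset T p) = coset T (loday p)"
  unfolding loday_boundary_def
  by (rule quot_map_coset[OF subspace_tensor_rel subspace_tensor_rel lin_linear_ext loday_tensor_rel])

section \<open>The boundary on the free Lie algebra\<close>

definition dif_quot :: "('v bracket_word \<Rightarrow>\<^sub>0 'k) set \<Rightarrow> ('v bracket_word \<Rightarrow>\<^sub>0 'k) set" where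
  "dif_quot = restrict (quot_map R dif) (free_lie scale)"

lemma dif_quot_coset: "dif_quot (coset R p) = coset R (dif p)"
  using quot_map_coset[OF subspace_lie_rel subspace_lie_rel lin_dif dif_lie_rel]
  by (simp add: dif_quot_def free_lie_def)

lemma is_lie_boundary_dif_quot: "is_lie_boundary scale br dif_quot"
  unfolding is_lie_boundary_def
proof (intro conjI ballI allI impI)
  show "dif_quot \<in> extensional (free_lie scale)"
    by (simp add: dif_quot_def)
  show "quot_linear R (free_lie scale) R (free_lie scale) dif_quot"
    unfolding free_lie_def
    by (rule quot_linear_image[OF subspace_lie_rel subspace_lie_rel fs.subspace_UNIV lin_dif dif_quot_coset UNIV_I])
  fix A assume "A \<in> free_lie_part scale 1"
  then obtain p where p: "p \<in> supported (\<lambda>w. bracket_length w = 1)" "A = coset R p"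
    by (auto simp: free_lie_part_def length_part_eq)
  show "dif_quot A = coset R 0"
    using lie_boundary_ext_length_one[OF commutator_supported[where P = "\<lambda>n. n = 1", OF p(1)], of br]
    by (simp only: p(2) dif_quot_coset)
next
  show "dif_quot (coset R (Poly_Mapping.single (right_normed xs) 1)) = coset R (lie_boundary_word br xs)"
    if "2 \<le> length xs" for xs
    using dif_right_normed[OF that] by (simp add: dif_quot_coset coset_eq_iff[OF subspace_lie_rel])
qed

lemma is_lie_boundary_unique:
  assumes d: "is_lie_boundary scale br d"
  shows "d = dif_quot"
proof (rule extensionalityI)
  show "d \<in> extensional (free_lie scale)" "dif_quot \<in> extensional (free_lie scale)"
    using d by (auto simp: is_lie_boundary_def dif_quot_def)
  \<comment> \<open>Agreement is tested on tensors through \<open>normalized_dynkin\<close>: this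
    set is a subspace containing every word, hence everything, and each class of the free Lie
    algebra is reached as that of some \<open>normalized_dynkin (comm p)\<close>.\<close>
  let ?S = "{q. d (coset R (normalized_dynkin q)) = coset R (lie_boundary_ext br q)}"
  have add: "d (coset R (p + q)) = coset R (p' + q')"
    if "d (coset R p) = coset R p'" "d (coset R q) = coset R q'" for p q p' q'
  proof -
    have "d (quot_add R (coset R p) (coset R q)) = quot_add R (d (coset R p)) (d (coset R q))"
      using d by (simp add: is_lie_boundary_def quot_linear_def free_lie_def)
    then show ?thesis by (simp add: that quot_add_coset[OF subspace_lie_rel])
  qed
  have scale: "d (coset R (fscale c p)) = coset R (fscale c p')" if "d (coset R p) = coset R p'" for c p p'
  proof -
    have "d (quot_scale R c (coset R p)) = quot_scale R c (d (coset R p))"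
      using d by (simp add: is_lie_boundary_def quot_linear_def free_lie_def)
    then show ?thesis by (simp add: that quot_scale_coset[OF subspace_lie_rel])
  qed
  have one: "d (coset R p) = coset R 0" if "p \<in> supported (\<lambda>w. bracket_length w = 1)" for p
    using d that by (auto simp: is_lie_boundary_def free_lie_part_def length_part_eq)
  have S: "fs.subspace ?S"
    using one[of 0] fs.subspace_0[OF subspace_supported]
    by (auto simp: fs.subspace_def add scale)
  have single: "Poly_Mapping.single xs 1 \<in> ?S" for xs
  proof -
    consider "xs = []" | x where "xs = [x]" | "length xs \<ge> 2" by (cases xs rule: remdups_adj.cases) auto
    then show ?thesis
    proof cases
      case 1
      then show ?thesis
        using one[of 0] fs.subspace_0[OF subspace_supported]
        by (auto simp: normalized_dynkin_def lie_boundary_ext_def)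
    next
      case 2
      then show ?thesis
        using one[of "Poly_Mapping.single (Gen x) 1"]
        by (simp add: normalized_dynkin_def lie_boundary_ext_def single_in_supported)
    next
      case 3
      then have "d (coset R (Poly_Mapping.single (right_normed xs) 1)) = coset R (lie_boundary_word br xs)"
        using d by (simp add: is_lie_boundary_def)
      from scale[OF this, of "1 / of_nat (length xs)"] show ?thesis
        using 3 by (simp add: normalized_dynkin_def lie_boundary_ext_def)
    qed
  qed
  fix A assume "A \<in> free_lie scale"
  then obtain p where A: "A = coset R p" by (auto simp: free_lie_def)
  have "linear_ext (\<lambda>xs. Poly_Mapping.single xs 1) (comm p) \<in> ?S"
    by (rule linear_ext_in_subspace[OF S single])
  moreover have "coset R (normalized_dynkin (comm p)) = A"
    by (simp add: A coset_eq_iff[OF subspace_lie_rel] normalized_dynkin_commutator)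
  ultimately show "d A = dif_quot A"
    by (simp add: linear_ext_id dif_quot_coset A)
qed

lemma lie_boundary_eq: "lie_boundary scale br = dif_quot"
  unfolding lie_boundary_def
  by (rule the_equality) (rule is_lie_boundary_dif_quot, erule is_lie_boundary_unique)

lemma loday_embedding:
  "loday_boundary scale br (lie_embedding scale (coset R p)) = lie_embedding scale (dif_quot (coset R p))"
  using comm_dif[of p]
  by (simp add: lie_embedding_coset loday_boundary_coset dif_quot_coset coset_eq_iff[OF subspace_tensor_rel])
    (metis fs.subspace_neg[OF subspace_tensor_rel] minus_diff_eq)

section \<open>The two complexes and the inclusion\<close>

lemma is_complex_free_lie:
  "is_complex R (free_lie scale) (free_lie_part scale) dif_quot"
  unfolding is_complex_def
proof (intro conjI allI impI ballI)
  show "quot_subspace R (free_lie scale)"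
    unfolding free_lie_def by (rule quot_subspace_image[OF subspace_lie_rel fs.subspace_UNIV])
  show "quot_subspace R (free_lie_part scale n)" for n
    unfolding free_lie_part_def by (rule length_part_subspace[OF subspace_lie_rel])
  show "free_lie_part scale n \<subseteq> free_lie scale" for n
    by (auto simp: free_lie_part_def length_part_def free_lie_def)
  show "quot_linear R (free_lie scale) R (free_lie scale) dif_quot"
    "dif_quot ` free_lie_part scale 1 \<subseteq> {coset R 0}"
    using is_lie_boundary_dif_quot by (auto simp: is_lie_boundary_def)
  show "dif_quot ` free_lie_part scale (Suc n) \<subseteq> free_lie_part scale n" for n
    using lie_boundary_ext_supported commutator_supported[where P = "\<lambda>m. m = Suc n"]
    by (fastforce simp: free_lie_part_def length_part_eq dif_quot_coset)
  show "dif_quot (dif_quot A) = coset R 0" if A: "A \<in> free_lie scale" for A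
  proof -
    obtain p where "A = coset R p" using A by (auto simp: free_lie_def)
    then show ?thesis by (simp add: dif_quot_coset coset_eq_iff[OF subspace_lie_rel] dif_dif)
  qed
qed

lemma is_complex_tensor_bar:
  "is_complex T (tensor_bar scale) (tensor_power scale) (loday_boundary scale br)"
  unfolding is_complex_def
proof (intro conjI allI impI ballI)
  show "quot_subspace T (tensor_bar scale)" "quot_subspace T (tensor_power scale n)" for n
    unfolding tensor_bar_def tensor_power_def by (rule length_part_subspace[OF subspace_tensor_rel])+
  show "tensor_power scale n \<subseteq> tensor_bar scale" if "n \<ge> 1" for n
    using that by (fastforce simp: tensor_power_def tensor_bar_def length_part_def)
  show "quot_linear T (tensor_bar scale) T (tensor_bar scale) (loday_boundary scale br)"
    unfolding tensor_bar_def length_part_eq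
    by (rule quot_linear_image[OF subspace_tensor_rel subspace_tensor_rel subspace_supported lin_linear_ext
          loday_boundary_coset loday_supported_pos])
  show "loday_boundary scale br ` tensor_power scale 1 \<subseteq> {coset T 0}"
    by (auto simp: tensor_power_def length_part_eq loday_boundary_coset loday_length_one[simplified])
  show "loday_boundary scale br ` tensor_power scale (Suc n) \<subseteq> tensor_power scale n" for n
    using loday_supported by (fastforce simp: tensor_power_def length_part_eq loday_boundary_coset)
  show "loday_boundary scale br (loday_boundary scale br A) = coset T 0" if A: "A \<in> tensor_bar scale" for A
  proof -
    obtain p where "A = coset T p" using A by (auto simp: tensor_bar_def length_part_eq)
    then show ?thesis
      by (simp add: loday_boundary_coset coset_eq_iff[OF subspace_tensor_rel] loday_square)
  qed
qed

lemma is_subcomplex_free_lie: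
  "is_subcomplex_via R (free_lie scale) (free_lie_part scale) dif_quot
     T (tensor_bar scale) (tensor_power scale) (loday_boundary scale br) (lie_embedding scale)"
  unfolding is_subcomplex_via_def
proof (intro conjI allI impI ballI)
  \<comment> \<open>Bracket words have positive length, so the image of \<epsilon> avoids the empty
    word.\<close>
  have pos: "comm p \<in> supported (\<lambda>xs. length xs \<ge> 1)" for p
    by (rule commutator_supported) (simp add: supported_def Suc_leI bracket_length_pos)
  show "quot_linear R (free_lie scale) T (tensor_bar scale) (lie_embedding scale)"
    unfolding free_lie_def tensor_bar_def length_part_eq
    by (rule quot_linear_image[OF subspace_lie_rel subspace_tensor_rel fs.subspace_UNIV lin_linear_ext
          lie_embedding_coset pos])
  show "inj_on (lie_embedding scale) (free_lie scale)"
    by (auto simp: inj_on_def free_lie_def lie_embedding_coset coset_eq_iff[OF subspace_tensor_rel]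
        coset_eq_iff[OF subspace_lie_rel] lie_rel_congI)
  show "lie_embedding scale ` free_lie_part scale n \<subseteq> tensor_power scale n" for n
    using commutator_supported[where P = "\<lambda>m. m = n"]
    by (fastforce simp: free_lie_part_def tensor_power_def length_part_eq lie_embedding_coset)
  show "loday_boundary scale br (lie_embedding scale A) = lie_embedding scale (dif_quot A)"
    if "A \<in> free_lie scale" for A
    using that by (auto simp: free_lie_def loday_embedding)
qed (rule is_complex_free_lie is_complex_tensor_bar)+

end

theorem theorem4p1:
  fixes scale :: "'k::field_char_0 \<Rightarrow> 'v::ab_group_add \<Rightarrow> 'v"
    and br :: "'v \<Rightarrow> 'v \<Rightarrow> 'v"
  assumes "leibniz_algebra scale br"
  shows "is_lie_boundary scale br (lie_boundary scale br) \<and>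
    (\<forall>\<alpha>\<in>free_lie scale.
       loday_boundary scale br (lie_embedding scale \<alpha>)
         = lie_embedding scale (lie_boundary scale br \<alpha>)) \<and>
    is_subcomplex_via
      (lie_rel scale) (free_lie scale) (free_lie_part scale) (lie_boundary scale br)
      (tensor_rel scale) (tensor_bar scale) (tensor_power scale) (loday_boundary scale br)
      (lie_embedding scale)"
proof -
  interpret leibniz_algebra_char_0 scale br
    using assms by (rule leibniz_algebra_char_0.intro)
  show ?thesis
    unfolding lie_boundary_eq
    using is_lie_boundary_dif_quot is_subcomplex_free_lie by (simp add: is_subcomplex_via_def)
qed

end
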